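(* Let $n\ge 3$ be an odd, square-free integer that is not a prime, and assume that every prime factor of $n$ is greater than $11$. Assume that $(x_0,\dots,x_4)\in G^5$ satisfies $(\tan x_0)^2=(\tan x_1)(\tan x_2)(\tan x_3)(\tan x_4)$ with $0<x_i<\frac{\pi}{2}$ and $\operatorname{den}(x_i)=4n$ for each $0\le i\le 4$. Then there exist a permutation $\sigma$ of $\{1,2,3,4\}$ and rationals $s,t$ with $0<s<\frac12$, $0<t\le\frac14$ such that $x_0=x_{\sigma(1)}=x_{\sigma(2)}=s\pi$, $x_{\sigma(3)}=t\pi$ and $x_{\sigma(4)}=(\frac12-t)\pi$.
   Context: $G:=\mathbb{Q}\pi$; for nonzero $g\in G$, $\operatorname{den}(g)$ is the denominator of $g/\pi$ in lowest terms. *)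

theory Defs
  imports
    Complex_Main
    "HOL-Computational_Algebra.Squarefree"
    "HOL-Combinatorics.Permutations"
begin

definition rat_pi :: "real set"  (* the group G = \<rat>\<pi> *)
  where "rat_pi = {real_of_rat q * pi | q. True}"

(* quotient_of returns the normalized fraction: coprime entries, positive second
   component.  The value is arbitrary for g outside rat_pi. *)
definition den :: "real \<Rightarrow> nat"
  where "den g = nat (snd (quotient_of (THE q. real_of_rat q = g / pi)))"

end

theory Submission
  imports
    Defs
    "HOL-Analysis.Analysis"
    "HOL-Real_Asymp.Real_Asymp"
    "HOL-Number_Theory.Number_Theory"
    "Jordan_Normal_Form.Char_Poly"
begin

text \<open>
  Write \<open>x\<^sub>i = \<pi> a\<^sub>i / 4n\<close> and \<open>z = exp (2\<pi>i / 4n)\<close>. The tangent relation is a polynomial equation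
  in \<open>z\<close>, so it persists under all conjugations \<open>z \<mapsto> z\<^sup>b\<close>. Taking logarithms and a Fourier
  transform on the units modulo \<open>4n\<close>, every character \<open>\<chi>\<close> at which the transform of
  \<open>b \<mapsto> ln |tan (\<pi> b / 4n)|\<close> does not vanish satisfies \<open>2 \<chi>(a\<^sub>0) = \<chi>(a\<^sub>1) + \<dots> + \<chi>(a\<^sub>4)\<close>.
  For primitive even \<open>\<chi>\<close> with \<open>\<chi>\<close> odd at \<open>4\<close> the transform is a nonzero multiple of
  \<open>L(1, \<chi>\<^sup>*)\<close>, with \<open>\<chi>\<^sup>*\<close> the conjugate, which is nonzero when \<open>\<chi>\<close> is not real.
  Averaging over these characters gives a function \<open>C\<close> on the units with
  \<open>2 C(1) = \<Sum> C(a\<^sub>i / a\<^sub>0)\<close>. As all prime factors of \<open>n\<close> are at least \<open>13\<close>,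
  \<open>C(a)\<close> is at most about \<open>2/7\<close> of \<open>C(1)\<close> unless \<open>a = \<plusminus>1\<close>; hence two of the \<open>a\<^sub>i\<close> equal \<open>a\<^sub>0\<close>,
  and the tangents at the other two angles are reciprocal.
\<close>

hide_const (open) up_ring.monom up_ring.coeff

section \<open>Conjugates of roots of unity\<close>


text \<open>The margins are tight. At each prime where a is not 1 the averaged character sum loses a
  factor of at least 7. If at most one a_i equalled a_0, the averaged identity would give C(1) <=
  (6/7) w, where w is the number of characters in the family. The obstacle is the term of C(1)
  belonging to -1. With a single prime its bound w/7 leaves C(1) >= (6/7) w and no contradiction,
  while a second prime lowers it to w/49.

  Oddness at 4 is what connects tangents with cyclotomic numbers. Up to a factor, the tangent is (1
  - z^b) / (1 + z^b), and for odd b the map z^b -> -z^b is multiplication of b by 1 + 2n, on which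
  these characters take the value -1. The transform of ln |tan| is then twice that of ln |1 -
  z^b|.\<close>

lemma binomial_prime_power:
  fixes a b :: "'a :: comm_ring_1"
  assumes "prime p"
  shows "\<exists>c. (a + b) ^ p = a ^ p + b ^ p + of_nat p * c"
proof -
  have p0: "p > 0" using assms prime_gt_0_nat by blast
  have "(a + b) ^ p = (\<Sum>k\<le>p. of_nat (p choose k) * a ^ k * b ^ (p - k))"
    by (rule binomial_ring)
  also have "{..p} = insert 0 (insert p {1..<p})" using p0 by auto
  also have "(\<Sum>k\<in>insert 0 (insert p {1..<p}). of_nat (p choose k) * a ^ k * b ^ (p - k))
    = a ^ p + b ^ p + (\<Sum>k\<in>{1..<p}. of_nat (p choose k) * a ^ k * b ^ (p - k))"
    using p0 by (simp add: algebra_simps)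
  also have "(\<Sum>k\<in>{1..<p}. of_nat (p choose k) * a ^ k * b ^ (p - k)) =
     of_nat p * (\<Sum>k\<in>{1..<p}. of_nat ((p choose k) div p) * a ^ k * b ^ (p - k))"
  proof (unfold sum_distrib_left, rule sum.cong[OF refl])
    fix k assume "k \<in> {1..<p}"
    hence "p dvd (p choose k)" using assms by (intro dvd_choose_prime) auto
    hence "(p choose k) = p * ((p choose k) div p)" by simp
    hence "of_nat (p choose k) = (of_nat p * of_nat ((p choose k) div p) :: 'a)"
      by (metis of_nat_mult)
    thus "of_nat (p choose k) * a ^ k * b ^ (p - k) = of_nat p * (of_nat ((p choose k) div p) * a ^ k * b ^ (p - k))"
      by (simp add: mult.assoc)
  qed
  finally show ?thesis by blast
qed

lemma int_fermat:
  assumes "prime p" shows "\<exists>c. (a::int) ^ p = a + int p * c"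
proof -
  have "[a ^ p = a] (mod int p)"
  proof (cases "int p dvd a")
    case True
    moreover have "int p dvd a ^ p" using True assms prime_gt_0_nat by (metis dvd_power dvd_trans)
    ultimately show ?thesis by (meson cong_dvd_iff cong_iff_dvd_diff dvd_diff)
  next
    case False
    have "p > 1" using assms prime_gt_1_nat by auto
    define b where "b = nat (a mod int p)"
    have b: "[int b = a] (mod int p)" using \<open>p > 1\<close> by (simp add: b_def cong_def)
    hence "\<not> p dvd b" using False by (metis cong_dvd_iff int_dvd_int_iff)
    hence "[b ^ (p - 1) = 1] (mod p)" using fermat_theorem[OF assms] by blast
    hence "[int b ^ (p - 1) = 1] (mod int p)" by (metis cong_int_iff of_nat_1 of_nat_power)
    hence "[a ^ (p - 1) = 1] (mod int p)" using b by (meson cong_pow cong_sym cong_trans)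
    hence "[a * a ^ (p - 1) = a * 1] (mod int p)" by (rule cong_scalar_left)
    thus ?thesis using \<open>p > 1\<close> by (metis One_nat_def Suc_pred gr0I mult.right_neutral not_one_less_zero power_Suc)
  qed
  then obtain c where "a ^ p - a = int p * c" by (metis cong_iff_dvd_diff dvdE)
  thus ?thesis by (intro exI[of _ c]) (simp add: algebra_simps)
qed

text \<open>This is the Frobenius map modulo p: the p-th power is additive up to multiples of p and
  fixes integers by Fermat, so it only replaces X by X^p. The cofactor is kept explicit so that the
  identity can be evaluated at a root of unity.\<close>

lemma poly_prime_power:
  fixes P :: "int poly"
  assumes "prime p"
  shows "\<exists>Q. P ^ p = pcompose P (monom 1 p) + of_nat p * Q"
proof (induction P)
  case 0
  show ?case using assms prime_gt_0_nat[of p] by (intro exI[of _ 0]) (auto simp: zero_power)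
next
  case (pCons a P)
  obtain Q where Q: "P ^ p = pcompose P (monom 1 p) + of_nat p * Q" using pCons by auto
  obtain c where c: "a ^ p = a + int p * c" using int_fermat[OF assms] by auto
  have "pCons a P = [:a:] + monom 1 1 * P" by (simp add: monom_altdef)
  then obtain R where R: "(pCons a P) ^ p = [:a:] ^ p + (monom 1 1 * P) ^ p + of_nat p * R"
    using binomial_prime_power[OF assms] by metis
  have m: "monom 1 (Suc 0) ^ p = (monom 1 p :: int poly)" by (simp add: monom_power)
  have "[:a:] ^ p = [:a ^ p:]" by (simp add: poly_const_pow)
  also have "\<dots> = [:a:] + of_nat p * [:c:]" by (simp add: c of_nat_poly)
  finally have "(pCons a P) ^ p = [:a:] + monom 1 p * pcompose P (monom 1 p) + of_nat p * ([:c:] + monom 1 p * Q + R)"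
    using R by (simp add: power_mult_distrib m Q algebra_simps)
  thus ?case by (metis pcompose_pCons)
qed

text \<open>As \<open>P\<close> varies, the values fill the ring Z[z]. Divisibility of y by p in
  that ring is expressed as \<open>y = of_nat p * ipoly_at Q z\<close>.\<close>

abbreviation ipoly_at :: "int poly \<Rightarrow> complex \<Rightarrow> complex" where
  "ipoly_at P z \<equiv> poly (of_int_poly P) z"

lemma ipoly_at_hom:
  "ipoly_at (P + Q) z = ipoly_at P z + ipoly_at Q z"
  "ipoly_at (P * Q) z = ipoly_at P z * ipoly_at Q z"
  "ipoly_at (- P) z = - ipoly_at P z"
  "ipoly_at (P ^ k) z = ipoly_at P z ^ k"
  "ipoly_at (of_nat k) z = of_nat k"
  "ipoly_at (pCons c P) z = of_int c + z * ipoly_at P z"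
  "ipoly_at (pcompose P Q) z = ipoly_at P (ipoly_at Q z)"
  "ipoly_at (monom 1 k) z = z ^ k"
  by (simp_all add: of_int_poly_hom.hom_add of_int_poly_hom.hom_mult of_int_poly_hom.hom_power
      of_int_poly_hom.hom_uminus of_int_hom.map_poly_pcompose poly_pcompose poly_monom of_int_hom.map_poly_hom_monom of_int_hom.map_poly_pCons_hom of_nat_poly)

lemma ipoly_at_prime_power:
  assumes "prime p" "ipoly_at P z = 0"
  shows "\<exists>Q. ipoly_at P (z ^ p) = of_nat p * ipoly_at Q z"
proof -
  obtain Q where Q: "P ^ p = pcompose P (monom 1 p) + of_nat p * Q"
    using poly_prime_power[OF assms(1)] by blast
  have "ipoly_at (P ^ p) z = 0" using assms prime_gt_0_nat[of p] by (simp add: ipoly_at_hom)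
  hence "ipoly_at P (z ^ p) + of_nat p * ipoly_at Q z = 0"
    unfolding Q ipoly_at_hom by simp
  hence "ipoly_at P (z ^ p) = of_nat p * ipoly_at (- Q) z"
    by (simp add: ipoly_at_hom eq_neg_iff_add_eq_0)
  thus ?thesis by blast
qed

text \<open>Multiplication by P(z) sends each of the powers 1, z, ..., z^(N-1) to an integer
  combination of them, exponents being reduced modulo N. So P(z) is an eigenvalue of the integer
  matrix \<open>B\<close> and a root of its monic characteristic polynomial; the powers may well be
  linearly dependent.\<close>

lemma algebraic_int_ipoly_at_root_of_unity:
  assumes "z ^ N = 1" "N > 0"
  shows "algebraic_int (ipoly_at P z)"
proof -
  define y where "y = ipoly_at P z"
  define B where "B = mat N N (\<lambda>(i,j). \<Sum>k\<in>{k. k \<le> degree P \<and> (i + k) mod N = j}. coeff P k)"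
  have B: "B \<in> carrier_mat N N" by (simp add: B_def)
  define C where "C = map_mat (of_int :: int \<Rightarrow> complex) B"
  have C: "C \<in> carrier_mat N N" by (simp add: C_def B)
  define v where "v = vec N (\<lambda>i. z ^ i)"
  have zmod: "z ^ (m mod N) = z ^ m" for m
    by (metis assms(1) div_mult_mod_eq mult.commute mult_1 power_add power_mult power_one)
  have "eigenvector C v y"
    unfolding eigenvector_def
  proof (intro conjI)
    show "v \<in> carrier_vec (dim_row C)" using C by (simp add: v_def)
    have "v $ 0 = 1" using assms by (simp add: v_def)
    thus "v \<noteq> 0\<^sub>v (dim_row C)" using C assms by auto
    show "C *\<^sub>v v = y \<cdot>\<^sub>v v"
    proof (rule eq_vecI)
      show "dim_vec (C *\<^sub>v v) = dim_vec (y \<cdot>\<^sub>v v)" using C by (simp add: v_def)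
      fix i assume "i < dim_vec (y \<cdot>\<^sub>v v)"
      hence i: "i < N" by (simp add: v_def)
      have "(C *\<^sub>v v) $ i = (\<Sum>j<N. of_int (B $$ (i,j)) * z ^ j)"
        using i B C by (auto simp: C_def v_def scalar_prod_def atLeast0LessThan intro!: sum.cong)
      also have "\<dots> = (\<Sum>j<N. \<Sum>k\<in>{k. k \<le> degree P \<and> (i + k) mod N = j}. of_int (coeff P k) * z ^ (i + k))"
      proof (rule sum.cong[OF refl])
        fix j assume "j \<in> {..<N}"
        hence "of_int (B $$ (i,j)) * z ^ j = (\<Sum>k\<in>{k. k \<le> degree P \<and> (i + k) mod N = j}. of_int (coeff P k)) * z ^ j"
          using i by (simp add: B_def)
        also have "\<dots> = (\<Sum>k\<in>{k. k \<le> degree P \<and> (i + k) mod N = j}. of_int (coeff P k) * z ^ (i + k))"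
          unfolding sum_distrib_right by (rule sum.cong) (auto simp: zmod)
        finally show "of_int (B $$ (i,j)) * z ^ j = \<dots>" .
      qed
      also have "\<dots> = (\<Sum>j<N. \<Sum>k\<in>{k \<in> {..degree P}. (i + k) mod N = j}. of_int (coeff P k) * z ^ (i + k))"
        by simp
      also have "\<dots> = (\<Sum>k\<le>degree P. of_int (coeff P k) * z ^ (i + k))"
        using assms by (intro sum.group) auto
      also have "\<dots> = y * z ^ i"
        by (simp add: y_def poly_altdef sum_distrib_left power_add mult_ac)
      finally show "(C *\<^sub>v v) $ i = (y \<cdot>\<^sub>v v) $ i" using i by (simp add: v_def)
    qed
  qed
  hence "eigenvalue C y" by (auto simp: eigenvalue_def)
  hence "poly (char_poly C) y = 0" using eigenvalue_root_char_poly[OF C] by simp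
  moreover have "char_poly C = of_int_poly (char_poly B)"
    unfolding C_def by (rule of_int_hom.char_poly_hom[OF B])
  moreover have "lead_coeff (char_poly B) = 1" using degree_monic_char_poly[OF B] by simp
  ultimately show ?thesis unfolding algebraic_int_altdef_ipoly y_def by metis
qed

text \<open>In a nonzero integer polynomial of least degree vanishing at y, the constant term c is
  nonzero, since otherwise a factor X could be removed. As c is a multiple of y in Z[z], a prime p
  dividing y makes c / p a rational algebraic integer, so p divides c.\<close>

lemma prime_divisors_bounded:
  assumes z: "z ^ N = 1" "N > 0" and y: "y = ipoly_at P z" "y \<noteq> 0"
  shows "\<exists>c. \<forall>p Q. prime p \<longrightarrow> y = of_nat p * ipoly_at Q z \<longrightarrow> p \<le> c"
proof -
  obtain g0 where "ipoly_at g0 y = 0" "lead_coeff g0 = 1"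
    using algebraic_int_ipoly_at_root_of_unity[OF z, of P]
    unfolding algebraic_int_altdef_ipoly y(1) by blast
  hence "g0 \<noteq> 0 \<and> ipoly_at g0 y = 0" by auto
  then obtain g where g: "g \<noteq> 0" "ipoly_at g y = 0"
    and min: "\<And>h. h \<noteq> 0 \<and> ipoly_at h y = 0 \<Longrightarrow> degree g \<le> degree h"
    using ex_has_least_nat[of "\<lambda>g. g \<noteq> 0 \<and> ipoly_at g y = 0" g0 degree] by blast
  obtain c h where gh: "g = pCons c h" by (cases g)
  have gy: "of_int c = - (y * ipoly_at h y)" 
    using g(2) unfolding gh ipoly_at_hom by (simp add: eq_neg_iff_add_eq_0)
  have "c \<noteq> 0"
  proof
    assume c: "c = 0"
    hence "h \<noteq> 0" using g gh by auto
    moreover have "ipoly_at h y = 0" using gy c y by simp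
    ultimately have "degree g \<le> degree h" using min by blast
    thus False using gh \<open>h \<noteq> 0\<close> by simp
  qed
  show ?thesis
  proof (intro exI[of _ "nat \<bar>c\<bar>"] allI impI)
    fix p Q assume p: "prime p" and Q: "y = of_nat p * ipoly_at Q z"
    define w where "w = ipoly_at (- (Q * pcompose h P)) z"
    have w: "of_int c = of_nat p * w" 
      unfolding gy w_def ipoly_at_hom y(1)[symmetric] by (subst (1) Q) simp
    have p0: "p > 0" using p prime_gt_0_nat by auto
    have "w = of_int c / of_nat p" using w p0 by simp
    hence "w \<in> \<rat>" by simp
    moreover have "algebraic_int w" unfolding w_def by (rule algebraic_int_ipoly_at_root_of_unity[OF z])
    ultimately have "w \<in> \<int>" by (blast intro: rational_algebraic_int_is_int)
    then obtain k where "w = of_int k" by (auto elim: Ints_cases)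
    hence "(of_int c :: complex) = of_int (int p * k)" using w by simp
    hence "c = int p * k" by (simp only: of_int_eq_iff)
    hence "int p dvd c" by simp
    hence "int p \<le> \<bar>c\<bar>" using \<open>c \<noteq> 0\<close> by (metis dvd_imp_le_int abs_of_nat)
    thus "p \<le> nat \<bar>c\<bar>" by simp
  qed
qed

text \<open>Landau's proof that \<open>z \<mapsto> z\<^sup>b\<close> is a conjugation: finitely many values \<open>P(z\<^sup>k)\<close> occur, so a large prime dividing one of them
  forces it to vanish; any residue class coprime to \<open>N\<close> contains a number without small prime factors.\<close>

lemma root_of_unity_conjugate:
  assumes z: "z ^ N = 1" "N > 0" and P: "ipoly_at P z = 0" and b: "coprime b N"
  shows "ipoly_at P (z ^ b) = 0"
proof -
  have zmod: "z ^ (m mod N) = z ^ m" for m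
    by (metis z(1) div_mult_mod_eq mult.commute mult_1 power_add power_mult power_one)
  have comp: "ipoly_at (pcompose P (monom 1 k)) w = ipoly_at P (w ^ k)" for k w
    by (simp only: ipoly_at_hom)
  have "\<exists>c. ipoly_at P (z ^ k) \<noteq> 0 \<longrightarrow> (\<forall>p Q. prime p \<longrightarrow> ipoly_at P (z ^ k) = of_nat p * ipoly_at Q z \<longrightarrow> p \<le> c)" for k
    using prime_divisors_bounded[OF z, of _ "pcompose P (monom 1 k)"] comp by metis
  then obtain c where c: "\<And>k p Q. ipoly_at P (z ^ k) \<noteq> 0 \<Longrightarrow> prime p \<Longrightarrow> ipoly_at P (z ^ k) = of_nat p * ipoly_at Q z \<Longrightarrow> p \<le> c k"
    by metis
  define A where "A = (\<Sum>k<N. c k)"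
  have step: "ipoly_at P (z ^ (k * p)) = 0" if p: "prime p" "p > A" and k: "ipoly_at P (z ^ k) = 0" for k p
  proof (rule ccontr)
    assume ne: "ipoly_at P (z ^ (k * p)) \<noteq> 0"
    define m where "m = (k * p) mod N"
    have m: "z ^ m = z ^ (k * p)" "m < N" using zmod z by (auto simp: m_def)
    obtain Q where Q: "ipoly_at P ((z ^ p) ^ k) = of_nat p * ipoly_at Q z"
      using ipoly_at_prime_power[OF p(1), of "pcompose P (monom 1 k)" z] k comp by auto
    have "(z ^ p) ^ k = z ^ m" unfolding m(1) by (simp add: mult.commute flip: power_mult)
    hence "ipoly_at P (z ^ m) = of_nat p * ipoly_at Q z" using Q by simp
    hence "p \<le> c m" using c[of m p Q] ne m p by auto
    also have "c m \<le> A" unfolding A_def using m by (intro member_le_sum) auto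
    finally show False using p by simp
  qed
  have all: "ipoly_at P (z ^ m) = 0" if "m > 0" "\<And>p. prime p \<Longrightarrow> p dvd m \<Longrightarrow> p > A" for m
    using that
  proof (induction m rule: less_induct)
    case (less m)
    show ?case
    proof (cases "m = 1")
      case True
      thus ?thesis using P by simp
    next
      case False
      then obtain p where p: "prime p" "p dvd m" using prime_factor_nat[OF False] by blast
      then obtain k where k: "m = k * p" by (metis dvdE mult.commute)
      have "k < m" "k > 0" using less.prems(1) k p prime_gt_1_nat[OF p(1)] by auto
      hence "ipoly_at P (z ^ k) = 0" using less k by (metis dvd_mult2)
      thus ?thesis using step p less.prems(2) k by blast
    qed
  qed
  \<comment> \<open>Among the primes up to \<open>A\<close>, one dividing b divides neither N nor
    any member of \<open>S\<close>, and any other lies in \<open>S\<close>. Either way it does not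
    divide m, and m has the residue of b modulo N.\<close>
  define S where "S = {p. prime p \<and> p \<le> A \<and> \<not> p dvd b}"
  have S: "finite S" unfolding S_def by (rule finite_subset[of _ "{..A}"]) auto
  define m where "m = b + N * \<Prod>S"
  have big: "p > A" if p: "prime p" "p dvd m" for p
  proof (rule ccontr)
    assume "\<not> p > A"
    hence pA: "p \<le> A" by simp
    show False
    proof (cases "p dvd b")
      case True
      hence "p dvd N * \<Prod>S" using p by (simp add: m_def dvd_add_right_iff)
      moreover have "\<not> p dvd N" using b True p(1) not_prime_unit coprime_common_divisor by blast
      ultimately have "p dvd \<Prod>S" using p by (simp add: prime_dvd_mult_iff)
      then obtain q where "q \<in> S" "p dvd q" using p(1) S by (meson prime_dvd_prod_iff)
      thus False using True p(1) unfolding S_def by (metis mem_Collect_eq primes_dvd_imp_eq)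
    next
      case False
      hence "p \<in> S" using pA p by (simp add: S_def)
      hence "p dvd N * \<Prod>S" using dvd_prodI[OF S, of p "\<lambda>x. x"] by (simp add: dvd_mult)
      thus False using False p by (simp add: m_def dvd_add_left_iff)
    qed
  qed
  have "\<Prod>S > 0" using S by (intro prod_pos) (auto simp: S_def intro: prime_gt_0_nat)
  hence "m > 0" using z by (simp add: m_def)
  hence "ipoly_at P (z ^ m) = 0" using all big by blast
  moreover have "z ^ m = z ^ b" by (simp add: m_def power_add power_mult z)
  ultimately show ?thesis by simp
qed

section \<open>Dirichlet series and Euler products\<close>

text \<open>Summation by parts introduces the nonnegative telescoping weights g k - g (k+1). The
  explicit bound matters as much as convergence: the estimates for nonprincipal L-series below are
  instances of it with suitable g.\<close>

lemma dirichlet_test: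
  fixes a :: "nat \<Rightarrow> complex" and g :: "nat \<Rightarrow> real"
  assumes M: "\<And>n. norm (\<Sum>k<n. a k) \<le> M"
    and dec: "\<And>k. g (Suc k) \<le> g k" and lim: "g \<longlonglongrightarrow> 0"
  shows "summable (\<lambda>k. a k * of_real (g k))" "norm (\<Sum>k. a k * of_real (g k)) \<le> M * g 0"
proof -
  define A where "A = (\<lambda>n. \<Sum>k<n. a k)"
  define d where "d = (\<lambda>k. g k - g (Suc k))"
  have M0: "M \<ge> 0" using M[of 0] by simp
  have d0: "d k \<ge> 0" for k using dec by (simp add: d_def)
  have "d sums (g 0 - 0)" unfolding d_def by (rule telescope_sums'[OF lim])
  hence Md: "(\<lambda>k. M * d k) sums (M * g 0)" using sums_mult by fastforce
  have bound: "norm (A (Suc k) * of_real (d k)) \<le> M * d k" for k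
    using M d0 by (auto simp: norm_mult A_def simp del: sum.lessThan_Suc intro!: mult_right_mono)
  have summ: "summable (\<lambda>k. A (Suc k) * of_real (d k))"
    by (rule summable_comparison_test'[OF sums_summable[OF Md]]) (use bound in auto)
  have parts: "(\<Sum>k<n. a k * of_real (g k)) = A n * of_real (g n) + (\<Sum>k<n. A (Suc k) * of_real (d k))" for n
    by (induction n) (auto simp: A_def d_def algebra_simps)
  have z: "(\<lambda>n. A n * of_real (g n)) \<longlonglongrightarrow> 0"
  proof (rule Lim_null_comparison)
    show "\<forall>\<^sub>F n in sequentially. norm (A n * of_real (g n)) \<le> M * \<bar>g n\<bar>"
      using M by (auto simp: norm_mult A_def intro!: mult_right_mono always_eventually)
    show "(\<lambda>n. M * \<bar>g n\<bar>) \<longlonglongrightarrow> 0" using tendsto_mult_left[OF tendsto_rabs[OF lim], of M] by simp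
  qed
  have "(\<lambda>n. A n * of_real (g n) + (\<Sum>k<n. A (Suc k) * of_real (d k))) \<longlonglongrightarrow> 0 + (\<Sum>k. A (Suc k) * of_real (d k))"
    by (intro tendsto_add z summable_LIMSEQ summ)
  hence s: "(\<lambda>k. a k * of_real (g k)) sums (\<Sum>k. A (Suc k) * of_real (d k))"
    unfolding sums_def parts by simp
  show "summable (\<lambda>k. a k * of_real (g k))" using s by (rule sums_summable)
  have "norm (\<Sum>k. A (Suc k) * of_real (d k)) \<le> (\<Sum>k. M * d k)"
    by (rule norm_suminf_le[OF bound sums_summable[OF Md]])
  thus "norm (\<Sum>k. a k * of_real (g k)) \<le> M * g 0"
    using sums_unique[OF s] sums_unique[OF Md] by simp
qed

text \<open>Each new prime q removes the subseries over multiples of q, which by complete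
  multiplicativity is f q times the current sum.\<close>

lemma sieved_series:
  fixes f :: "nat \<Rightarrow> complex"
  assumes mult: "\<And>a b. f (a * b) = f a * f b" and summ: "summable (\<lambda>k. norm (f k))"
    and A: "finite A" "\<And>p. p \<in> A \<Longrightarrow> prime p"
  shows "(\<lambda>k. if \<exists>p\<in>A. p dvd k then 0 else f k) sums ((\<Sum>k. f k) * (\<Prod>p\<in>A. 1 - f p))"
  using A
proof (induction A rule: finite_induct)
  case empty
  thus ?case using summ by (simp add: summable_norm_cancel summable_sums)
next
  case (insert q A)
  define h where "h = (\<lambda>k. if \<exists>p\<in>A. p dvd k then 0 else f k)"
  define c where "c = (\<Sum>k. f k) * (\<Prod>p\<in>A. 1 - f p)"
  have h: "h sums c" using insert by (simp add: h_def c_def)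
  have q: "prime q" "q > 0" using insert.prems prime_gt_0_nat by auto
  have hq: "h (q * k) = f q * h k" for k
  proof -
    have "p dvd q * k \<longleftrightarrow> p dvd k" if "p \<in> A" for p
      using that insert q(1) by (metis insert_iff prime_dvd_mult_iff primes_dvd_imp_eq)
    thus ?thesis by (auto simp: h_def mult)
  qed
  have "(\<lambda>k. f q * h k) sums (f q * c)" using h by (rule sums_mult)
  hence "(\<lambda>k. (\<lambda>m. if q dvd m then h m else 0) (q * k)) sums (f q * c)" by (simp add: hq)
  moreover have "strict_mono (\<lambda>k. q * k)" using q by (simp add: strict_mono_def)
  ultimately have "(\<lambda>m. if q dvd m then h m else 0) sums (f q * c)"
    by (subst (asm) sums_mono_reindex) auto
  hence "(\<lambda>m. h m - (if q dvd m then h m else 0)) sums (c - f q * c)"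
    using h by (intro sums_diff)
  also have "(\<lambda>m. h m - (if q dvd m then h m else 0)) = (\<lambda>k. if \<exists>p\<in>insert q A. p dvd k then 0 else f k)"
    by (auto simp: h_def)
  also have "c - f q * c = (\<Sum>k. f k) * (\<Prod>p\<in>insert q A. 1 - f p)"
    using insert by (simp add: c_def algebra_simps)
  finally show ?case .
qed

text \<open>After sieving by the primes up to P, only the term at 1 and terms beyond P survive, and
  the latter are bounded by the tail of a convergent series. Keeping the inverse Euler factors on
  the left avoids any division.\<close>

lemma euler_product:
  fixes f :: "nat \<Rightarrow> complex"
  assumes mult: "\<And>a b. f (a * b) = f a * f b" and f01: "f 0 = 0" "f 1 = 1"
    and summ: "summable (\<lambda>k. norm (f k))"
  shows "(\<lambda>P. (\<Sum>k. f k) * (\<Prod>p | prime p \<and> p \<le> P. 1 - f p)) \<longlonglongrightarrow> 1"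
proof (rule LIMSEQ_I)
  fix e :: real assume e: "e > 0"
  obtain K where K: "\<And>n. n \<ge> K \<Longrightarrow> (\<Sum>k. norm (f (k + n))) < e"
    using suminf_exist_split[OF e summ] by (metis abs_less_iff real_norm_def)
  show "\<exists>n0. \<forall>P\<ge>n0. norm ((\<Sum>k. f k) * (\<Prod>p | prime p \<and> p \<le> P. 1 - f p) - 1) < e"
  proof (intro exI[of _ "K + 1"] allI impI)
    fix P assume P: "P \<ge> K + 1"
    define A where "A = {p. prime p \<and> p \<le> P}"
    have A: "finite A" "\<And>p. p \<in> A \<Longrightarrow> prime p" unfolding A_def by auto
    define h where "h = (\<lambda>k. if \<exists>p\<in>A. p dvd k then 0 else f k)"
    have h: "h sums ((\<Sum>k. f k) * (\<Prod>p\<in>A. 1 - f p))"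
      unfolding h_def by (rule sieved_series[OF mult summ A])
    have h0: "h k = (if k = 1 then 1 else 0)" if "k < P + 1" for k
    proof (cases "k = 0 \<or> k = 1")
      case True
      thus ?thesis using f01 A(2)[of 1] by (auto simp: h_def)
    next
      case False
      then obtain p where p: "prime p" "p dvd k" using prime_factor_nat[of k] by blast
      have "p \<le> k" using p False by (simp add: dvd_imp_le)
      hence "p \<in> A" using p that by (simp add: A_def)
      thus ?thesis using p False by (auto simp: h_def)
    qed
    have "(\<Sum>k<P+1. h k) = (\<Sum>k<P+1. if k = 1 then 1 else 0)"
      by (rule sum.cong) (use h0 in auto)
    also have "\<dots> = 1" using P by (simp add: sum.delta)
    finally have "(\<lambda>k. h (k + (P + 1))) sums ((\<Sum>k. f k) * (\<Prod>p\<in>A. 1 - f p) - 1)"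
      using sums_split_initial_segment[OF h, of "P + 1"] by simp
    hence "norm ((\<Sum>k. f k) * (\<Prod>p\<in>A. 1 - f p) - 1) = norm (\<Sum>k. h (k + (P + 1)))"
      by (simp add: sums_iff)
    also have "\<dots> \<le> (\<Sum>k. norm (f (k + (P + 1))))"
      by (rule norm_suminf_le[OF _ summable_ignore_initial_segment[OF summ]]) (simp add: h_def)
    also have "\<dots> < e" using K[of "P + 1"] P by simp
    finally show "norm ((\<Sum>k. f k) * (\<Prod>p | prime p \<and> p \<le> P. 1 - f p) - 1) < e"
      by (simp add: A_def)
  qed
qed

text \<open>For z = exp(it), minus the logarithm of the product is a series whose terms are r^m / m
  times 3 + 4 cos(mt) + cos(2mt) = 2 (1 + cos(mt))^2. The case z = 0 covers the primes dividing the
  modulus.\<close>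

lemma three_four_one:
  fixes z :: complex
  assumes r: "0 \<le> r" "r < 1" and z: "z = 0 \<or> norm z = 1"
  shows "(1 - r) ^ 3 * norm (1 - of_real r * z) ^ 4 * norm (1 - of_real r * z ^ 2) \<le> 1"
proof (cases "z = 0")
  case True
  thus ?thesis using r by (simp add: power_le_one)
next
  case False
  hence z1: "norm z = 1" using z by auto
  \<comment> \<open>The series starts at m = 0, where division by zero makes the term 0.\<close>
  have ser: "(\<lambda>m. r ^ m * Re (w ^ m) / real m) sums (- ln (norm (1 - of_real r * w)))"
    if "norm w = 1" for w :: complex
  proof -
    have lt: "norm (- (of_real r * w)) < 1" using that r by (simp add: norm_mult)
    have ne: "1 - of_real r * w \<noteq> 0" using lt by auto
    have "(\<lambda>m. - ((of_real r * w) ^ m) / of_nat m) sums Ln (1 - of_real r * w)"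
      using Ln_series'[OF lt] by simp
    hence "(\<lambda>m. - (- ((of_real r * w) ^ m) / of_nat m)) sums (- Ln (1 - of_real r * w))"
      by (rule sums_minus)
    hence "(\<lambda>m. Re (- (- ((of_real r * w) ^ m) / of_nat m))) sums Re (- Ln (1 - of_real r * w))"
      by (rule sums_Re)
    moreover have "Re (- (- ((of_real r * w) ^ m) / of_nat m)) = r ^ m * Re (w ^ m) / real m" for m
    proof -
      have "- (- ((of_real r * w) ^ m) / of_nat m) = of_real (r ^ m / real m) * w ^ m"
        by (simp add: power_mult_distrib)
      thus ?thesis by (metis scaleR_conv_of_real scaleR_complex.sel(1) times_divide_eq_left)
    qed
    ultimately have "(\<lambda>m. r ^ m * Re (w ^ m) / real m) sums Re (- Ln (1 - of_real r * w))"
      by (simp only:)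
    thus ?thesis using ne by simp
  qed
  have S: "(\<lambda>m. 3 * (r ^ m * Re (1 ^ m) / real m) + 4 * (r ^ m * Re (z ^ m) / real m) + r ^ m * Re ((z ^ 2) ^ m) / real m)
    sums (3 * (- ln (norm (1 - of_real r * 1 :: complex))) + 4 * (- ln (norm (1 - of_real r * z))) + (- ln (norm (1 - of_real r * z ^ 2))))"
    using z1 by (intro sums_add sums_mult ser) (auto simp: norm_power)
  have nonneg: "3 * (r ^ m * Re (1 ^ m) / real m) + 4 * (r ^ m * Re (z ^ m) / real m) + r ^ m * Re ((z ^ 2) ^ m) / real m \<ge> 0" for m
  proof -
    have "norm (z ^ m) = 1" using z1 by (simp add: norm_power)
    hence n1: "Re (z ^ m) ^ 2 + Im (z ^ m) ^ 2 = 1" by (metis cmod_power2 one_power2)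
    have "Re ((z ^ 2) ^ m) = Re ((z ^ m) ^ 2)" by (simp add: mult.commute flip: power_mult)
    also have "\<dots> = Re (z ^ m) ^ 2 - Im (z ^ m) ^ 2" by (simp add: power2_eq_square)
    finally have "3 + 4 * Re (z ^ m) + Re ((z ^ 2) ^ m) = 2 * (1 + Re (z ^ m)) ^ 2"
      using n1 by (simp add: power2_eq_square algebra_simps)
    hence "0 \<le> r ^ m * (3 + 4 * Re (z ^ m) + Re ((z ^ 2) ^ m)) / real m"
      using r by simp
    thus ?thesis by (simp add: algebra_simps add_divide_distrib)
  qed
  have "3 * (- ln (norm (1 - of_real r * 1 :: complex))) + 4 * (- ln (norm (1 - of_real r * z))) + (- ln (norm (1 - of_real r * z ^ 2))) \<ge> 0"
    by (rule sums_le[OF nonneg sums_zero S])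
  moreover have "norm (1 - of_real r * 1 :: complex) = 1 - r"
    using r by (metis abs_of_pos diff_gt_0_iff_gt mult.right_neutral norm_of_real of_real_1 of_real_diff)
  ultimately have le: "3 * ln (1 - r) + 4 * ln (norm (1 - of_real r * z)) + ln (norm (1 - of_real r * z ^ 2)) \<le> 0"
    by simp
  have ne: "norm (1 - of_real r * w) > 0" if "norm w = 1" for w :: complex
  proof -
    have "norm (of_real r * w) < 1" using that r by (simp add: norm_mult)
    hence "of_real r * w \<noteq> 1" by auto
    thus ?thesis by simp
  qed
  have p1: "norm (1 - of_real r * z) > 0" "norm (1 - of_real r * z ^ 2) > 0"
    using ne z1 by (auto simp: norm_power)
  have "ln ((1 - r) ^ 3 * norm (1 - of_real r * z) ^ 4 * norm (1 - of_real r * z ^ 2)) \<le> 0"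
    using le p1 r by (simp add: ln_mult ln_realpow)
  thus ?thesis using p1 r by (subst (asm) ln_le_zero_iff) auto
qed

lemma zeta_upper_bound:
  fixes e :: real
  assumes "e > 0"
  shows "summable (\<lambda>k. real (Suc k) powr - (1 + e))" "(\<Sum>k. real (Suc k) powr - (1 + e)) \<le> 1 + 1 / e"
proof -
  \<comment> \<open>\<open>d k\<close> is the integral of t powr -(1 + e) from k + 1 to k + 2, so
    these terms dominate the shifted series and telescope to 1 / e.\<close>
  define d where "d = (\<lambda>k. (real (Suc k) powr - e - real (Suc (Suc k)) powr - e) / e)"
  have lim: "(\<lambda>k. real (Suc k) powr - e) \<longlonglongrightarrow> 0"
    using assms by (intro LIMSEQ_Suc) (real_asymp)
  have d: "d sums (1 / e)"
    using sums_divide[OF telescope_sums'[OF lim], of e] by (simp add: d_def)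
  have bound: "real (Suc (Suc k)) powr - (1 + e) \<le> d k" for k
  proof -
    have "\<exists>t>real (Suc k). t < real (Suc (Suc k)) \<and> real (Suc (Suc k)) powr - e - real (Suc k) powr - e
       = (real (Suc (Suc k)) - real (Suc k)) * (- e * t powr (- e - 1))"
      by (rule MVT2) (auto intro!: derivative_eq_intros)
    then obtain t where t: "t > real (Suc k)" "t < real (Suc (Suc k))"
      "real (Suc (Suc k)) powr - e - real (Suc k) powr - e = - e * t powr (- e - 1)" by auto
    have "real (Suc (Suc k)) powr - (1 + e) \<le> t powr - (1 + e)"
      using t assms by (intro powr_mono2') auto
    moreover have e1: "- e - 1 = - (1 + e)" by simp
    have "real (Suc k) powr - e - real (Suc (Suc k)) powr - e = t powr - (1 + e) * e"
      using t(3)[unfolded e1] by (simp only: mult.commute mult_minus_right algebra_simps)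
    hence "d k = t powr - (1 + e)" using assms unfolding d_def by simp
    ultimately show ?thesis by (simp only:)
  qed
  have s: "summable (\<lambda>k. real (Suc (Suc k)) powr - (1 + e))"
    by (rule summable_comparison_test'[OF sums_summable[OF d]]) (use bound in auto)
  thus s': "summable (\<lambda>k. real (Suc k) powr - (1 + e))" by (subst (asm) summable_Suc_iff)
  have "(\<Sum>k. real (Suc (Suc k)) powr - (1 + e)) \<le> 1 / e"
    using suminf_le[OF bound s sums_summable[OF d]] sums_unique[OF d] by simp
  thus "(\<Sum>k. real (Suc k) powr - (1 + e)) \<le> 1 + 1 / e"
    using suminf_split_head[OF s'] by simp
qed

section \<open>Nonvanishing at 1 of non-real Dirichlet L-series\<close>

locale dirichlet_character =
  fixes N :: nat and \<psi> :: "nat \<Rightarrow> complex"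
  assumes modulus_pos: "N > 0"
    and mult: "\<psi> (a * b) = \<psi> a * \<psi> b"
    and periodic: "\<psi> (a + N) = \<psi> a"
    and eq_0_iff: "\<psi> a = 0 \<longleftrightarrow> \<not> coprime a N"
begin

lemma one [simp]: "\<psi> 1 = 1" "\<psi> (Suc 0) = 1"
proof -
  have "\<psi> 1 * \<psi> 1 = \<psi> 1" using mult[of 1 1] by simp
  moreover have "\<psi> 1 \<noteq> 0" using eq_0_iff by simp
  ultimately show "\<psi> 1 = 1" by simp
  thus "\<psi> (Suc 0) = 1" by simp
qed

lemma power: "\<psi> (a ^ k) = \<psi> a ^ k"
  by (induction k) (auto simp: mult)

lemma periodic_mult: "\<psi> (a + q * N) = \<psi> a"
  by (induction q) (auto simp: periodic add.assoc[symmetric] add.commute[of N])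

lemma mod_modulus: "\<psi> (a mod N) = \<psi> a"
  using periodic_mult[of "a mod N" "a div N"] by simp

lemma cong_modulus: "[a = b] (mod N) \<Longrightarrow> \<psi> a = \<psi> b"
  using mod_modulus[of a] mod_modulus[of b] by (simp add: unique_euclidean_semiring_class.cong_def)

lemma norm_eq_1: "coprime a N \<Longrightarrow> norm (\<psi> a) = 1"
proof -
  assume a: "coprime a N"
  have "\<psi> a ^ totient N = \<psi> 1"
    unfolding power[symmetric] by (rule cong_modulus) (rule euler_theorem[OF a])
  hence "norm (\<psi> a) = 1 \<or> totient N = 0" by (intro power_eq_1_iff) simp
  thus ?thesis using modulus_pos by simp
qed

lemma norm_le_1: "norm (\<psi> a) \<le> 1"
  by (cases "coprime a N") (auto simp: norm_eq_1 eq_0_iff[THEN iffD2])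

lemma cnj_mult_self: "coprime a N \<Longrightarrow> cnj (\<psi> a) * \<psi> a = 1"
  by (metis complex_norm_square mult.commute norm_eq_1 of_real_1 one_power2)

end

lemma sum_mod_reindex:
  fixes u N :: nat
  assumes "coprime u N"
  shows "(\<Sum>a<N. h (u * a mod N)) = (\<Sum>a<N. h a :: 'a :: comm_monoid_add)"
proof (rule sum.reindex_bij_betw)
  have inj: "inj_on (\<lambda>a. u * a mod N) {..<N}"
  proof (rule inj_onI)
    fix a b assume ab: "a \<in> {..<N}" "b \<in> {..<N}" "u * a mod N = u * b mod N"
    hence "[u * a = u * b] (mod N)" by (simp add: unique_euclidean_semiring_class.cong_def)
    hence "[a = b] (mod N)" using assms by (simp add: cong_mult_lcancel_nat)
    thus "a = b" using ab by (simp add: unique_euclidean_semiring_class.cong_def)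
  qed
  moreover have "(\<lambda>a. u * a mod N) ` {..<N} \<subseteq> {..<N}" by auto
  ultimately show "bij_betw (\<lambda>a. u * a mod N) {..<N} {..<N}"
    unfolding bij_betw_def by (simp add: endo_inj_surj)
qed

section \<open>Partial sums and L-series of nonprincipal characters\<close>

locale nonprincipal_character = dirichlet_character +
  assumes nonprincipal: "\<exists>u. coprime u N \<and> \<psi> u \<noteq> 1"
begin

lemma sum_period: "(\<Sum>a<N. \<psi> a) = 0"
proof -
  obtain u where u: "coprime u N" "\<psi> u \<noteq> 1" using nonprincipal by blast
  have "(\<Sum>a<N. \<psi> a) = (\<Sum>a<N. \<psi> (u * a mod N))" by (rule sum_mod_reindex[OF u(1), symmetric])
  also have "\<dots> = \<psi> u * (\<Sum>a<N. \<psi> a)" by (simp add: mod_modulus mult sum_distrib_left)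
  finally show ?thesis using u by simp
qed

lemma sum_initial: "(\<Sum>a<n. \<psi> a) = (\<Sum>a<n mod N. \<psi> a)"
proof -
  have "(\<Sum>a<r + q * N. \<psi> a) = (\<Sum>a<r. \<psi> a)" for r q
  proof (induction q)
    case (Suc q)
    have "(\<Sum>a<N + m. \<psi> a) = (\<Sum>a<m. \<psi> a)" for m
    proof -
      have "(\<Sum>a<N + m. \<psi> a) = (\<Sum>a<N. \<psi> a) + (\<Sum>a<m. \<psi> (N + a))"
        by (simp add: lessThan_atLeast0 sum.atLeastLessThan_concat[symmetric, of 0 N "N + m"] sum.shift_bounds_nat_ivl[symmetric] sum.atLeastLessThan_shift_0[of _ N])
      thus ?thesis by (simp add: sum_period add.commute[of N] periodic)
    qed
    thus ?case using Suc by (simp add: add.left_commute)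
  qed auto
  from this[of "n mod N" "n div N"] show ?thesis by simp
qed

lemma norm_sum_le: "norm (\<Sum>k<n. \<psi> (Suc k)) \<le> N"
proof -
  have "(\<Sum>k<n. \<psi> (Suc k)) = (\<Sum>k<Suc n. \<psi> k) - \<psi> 0"
    by (subst sum.lessThan_Suc_shift) simp
  also have "\<dots> = (\<Sum>k\<in>{..<Suc n mod N} - {0}. \<psi> k)"
  proof (cases "Suc n mod N = 0")
    case False
    thus ?thesis by (subst sum_initial) (simp add: sum_diff1)
  next
    case True
    hence "(\<Sum>k<Suc n. \<psi> k) = 0" by (subst sum_initial) simp
    moreover have "\<psi> 0 = 0 \<or> N = 1" using eq_0_iff[of 0] by simp
    moreover have "N \<noteq> 1" using sum_period eq_0_iff[of 0] by auto
    ultimately show ?thesis using True by simp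
  qed
  also have "norm \<dots> \<le> (\<Sum>k\<in>{..<Suc n mod N} - {0}. 1)"
    by (intro sum_norm_le norm_le_1)
  also have "\<dots> \<le> real (card {..<Suc n mod N})" using card_mono[of "{..<Suc n mod N}" "{..<Suc n mod N} - {0}"] by simp
  also have "\<dots> \<le> real N" using modulus_pos by (simp add: less_imp_le)
  finally show ?thesis .
qed

lemmas L_test = dirichlet_test[OF norm_sum_le]

lemma L1_summable: "summable (\<lambda>k. \<psi> (Suc k) / of_nat (Suc k))"
proof -
  have "(\<lambda>k. 1 / real (Suc k)) \<longlonglongrightarrow> 0" by real_asymp
  from L_test(1)[OF _ this] show ?thesis by (simp add: field_simps)
qed

lemma L_bound:
  assumes "s > 0"
  shows "norm (\<Sum>k. \<psi> (Suc k) * of_real (real (Suc k) powr - s)) \<le> N"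
proof -
  have "(\<lambda>k. real (Suc k) powr - s) \<longlonglongrightarrow> 0" using assms by real_asymp
  moreover have "real (Suc (Suc k)) powr - s \<le> real (Suc k) powr - s" for k
    using assms by (intro powr_mono2') auto
  ultimately show ?thesis using L_test(2)[of "\<lambda>k. real (Suc k) powr - s"] by simp
qed

text \<open>\<open>1/t - t powr - (1 + e)\<close> is not monotone, but it is the difference of the two decreasing
  functions \<open>P\<close> and \<open>Q\<close> below, each of size at most \<open>e\<close> at \<open>t = 1\<close>.\<close>

lemma L_near_1:
  fixes e :: real
  assumes e: "e > 0"
  shows "norm ((\<Sum>k. \<psi> (Suc k) * of_real (real (Suc k) powr - (1 + e))) - (\<Sum>k. \<psi> (Suc k) / of_nat (Suc k))) \<le> 2 * real N * e"
proof -
  define Q where "Q = (\<lambda>t :: real. e / (1 + e) * t powr - (1 + e))"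
  \<comment> \<open>The weight 1 / (1 + e) makes the derivative t powr (-2 - e) - t powr -2, which
    is nonpositive for t >= 1.\<close>
  define P where "P = (\<lambda>t :: real. t powr - 1 - 1 / (1 + e) * t powr - (1 + e))"
  have Q: "(\<lambda>k. Q (real (Suc k))) \<longlonglongrightarrow> 0" using e unfolding Q_def by real_asymp
  have dQ: "Q (real (Suc (Suc k))) \<le> Q (real (Suc k))" for k
    unfolding Q_def using e by (intro mult_left_mono powr_mono2') auto
  have P: "(\<lambda>k. P (real (Suc k))) \<longlonglongrightarrow> 0" using e unfolding P_def by real_asymp
  have dP: "P (real (Suc (Suc k))) \<le> P (real (Suc k))" for k
  proof (rule DERIV_nonpos_imp_nonincreasing[where f = P])
    fix t assume t: "real (Suc k) \<le> t" "t \<le> real (Suc (Suc k))"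
    have t0: "t > 0" using t by simp
    have "(P has_real_derivative - 1 * t powr (- 1 - 1) - 1 / (1 + e) * (- (1 + e) * t powr (- (1 + e) - 1))) (at t)"
      unfolding P_def by (intro DERIV_diff DERIV_cmult has_real_derivative_powr t0)
    moreover have c: "1 / (1 + e) * (- (1 + e) * t powr (- (1 + e) - 1)) = - (t powr (- (1 + e) - 1))"
      using e by (simp only: mult_minus_left mult_minus_right) (simp add: field_simps)
    ultimately have "(P has_real_derivative t powr (- 2 - e) - t powr - 2) (at t)" by simp
    moreover have "t powr (- 2 - e) \<le> t powr - 2" using t e by (intro powr_mono) auto
    ultimately show "\<exists>y. (P has_real_derivative y) (at t) \<and> y \<le> 0" by force
  qed simp
  note tP = L_test[of "\<lambda>k. P (real (Suc k))", OF dP P]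
  note tQ = L_test[of "\<lambda>k. Q (real (Suc k))", OF dQ Q]
  have e1: "e / (1 + e) \<le> e" using e by (simp add: field_simps)
  moreover have "1 - 1 / (1 + e) = e / (1 + e)" using e by (simp add: field_simps)
  ultimately have "P (real (Suc 0)) \<le> e" "Q (real (Suc 0)) \<le> e" by (simp_all add: P_def Q_def)
  hence le: "norm (\<Sum>k. \<psi> (Suc k) * of_real (P (real (Suc k)))) \<le> real N * e"
    "norm (\<Sum>k. \<psi> (Suc k) * of_real (Q (real (Suc k)))) \<le> real N * e"
    by (auto intro!: order.trans[OF tP(2)] order.trans[OF tQ(2)] mult_left_mono simp del: of_nat_Suc)
  define S where "S = (\<lambda>k. \<psi> (Suc k) * of_real (real (Suc k) powr - (1 + e)))"
  have "S = (\<lambda>k. \<psi> (Suc k) / of_nat (Suc k) - (\<psi> (Suc k) * of_real (P (real (Suc k))) - \<psi> (Suc k) * of_real (Q (real (Suc k)))))"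
  proof
    fix k
    have "1 / (1 + e) + e / (1 + e) = 1" using e by (simp add: field_simps)
    moreover have "P t - Q t = t powr - 1 - (1 / (1 + e) + e / (1 + e)) * t powr - (1 + e)" for t
      unfolding P_def Q_def distrib_right by simp
    ultimately have "P (real (Suc k)) - Q (real (Suc k)) = 1 / real (Suc k) - real (Suc k) powr - (1 + e)"
      by (simp add: powr_minus_divide)
    hence "of_real (P (real (Suc k))) - of_real (Q (real (Suc k))) = (1 / of_nat (Suc k) - of_real (real (Suc k) powr - (1 + e)) :: complex)"
      by (metis of_real_1 of_real_diff of_real_divide of_real_of_nat_eq)
    hence "\<psi> (Suc k) * (of_real (P (real (Suc k))) - of_real (Q (real (Suc k)))) = \<psi> (Suc k) * (1 / of_nat (Suc k) - of_real (real (Suc k) powr - (1 + e)))"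
      by (simp only:)
    thus "S k = \<psi> (Suc k) / of_nat (Suc k) - (\<psi> (Suc k) * of_real (P (real (Suc k))) - \<psi> (Suc k) * of_real (Q (real (Suc k))))"
      by (simp add: S_def algebra_simps)
  qed
  hence "(\<Sum>k. S k) = (\<Sum>k. \<psi> (Suc k) / of_nat (Suc k)) - ((\<Sum>k. \<psi> (Suc k) * of_real (P (real (Suc k)))) - (\<Sum>k. \<psi> (Suc k) * of_real (Q (real (Suc k)))))"
    by (simp only: suminf_diff L1_summable tP(1) tQ(1) summable_diff)
  hence "norm ((\<Sum>k. S k) - (\<Sum>k. \<psi> (Suc k) / of_nat (Suc k))) =
    norm ((\<Sum>k. \<psi> (Suc k) * of_real (P (real (Suc k)))) - (\<Sum>k. \<psi> (Suc k) * of_real (Q (real (Suc k)))))"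
    by (simp add: norm_minus_commute)
  also have "\<dots> \<le> real N * e + real N * e" by (rule order.trans[OF norm_triangle_ineq4 add_mono[OF le]])
  finally show ?thesis by (simp only: S_def mult_2 distrib_right)
qed

text \<open>The error terms (1 - r^k) / k are (1 - r) times the mean of 1, r, ..., r^(k-1), hence
  decreasing in k. The Dirichlet test then bounds the whole error by N (1 - r).\<close>

lemma abel_limit:
  assumes lim: "((\<lambda>r. \<Sum>k. \<psi> (Suc k) / of_nat (Suc k) * of_real r ^ Suc k) \<longlongrightarrow> c) (at_left 1)"
  shows "(\<Sum>k. \<psi> (Suc k) / of_nat (Suc k)) = c"
proof -
  define F where "F = (\<lambda>r :: real. \<Sum>k. \<psi> (Suc k) / of_nat (Suc k) * of_real r ^ Suc k)"
  define L where "L = (\<Sum>k. \<psi> (Suc k) / of_nat (Suc k))"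
  have F: "norm (F r - L) \<le> real N * (1 - r)" if r: "0 < r" "r < 1" for r :: real
  proof -
    define g where "g = (\<lambda>k. (1 - r ^ Suc k) / real (Suc k))"
    have lim: "g \<longlonglongrightarrow> 0" unfolding g_def using r by real_asymp
    have dec: "g (Suc k) \<le> g k" for k
    proof -
      have g: "g j = (1 - r) * ((\<Sum>i<Suc j. r ^ i) / real (Suc j))" for j
        using one_diff_power_eq[of r "Suc j"] by (simp add: g_def del: power_Suc)
      have "(\<Sum>i<Suc k. r ^ Suc k) \<le> (\<Sum>i<Suc k. r ^ i)"
        using r by (intro sum_mono power_decreasing) auto
      hence "real (Suc k) * r ^ Suc k \<le> (\<Sum>i<Suc k. r ^ i)" by simp
      hence "(\<Sum>i<Suc (Suc k). r ^ i) / real (Suc (Suc k)) \<le> (\<Sum>i<Suc k. r ^ i) / real (Suc k)"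
        unfolding sum.lessThan_Suc[of _ "Suc k"] by (simp add: divide_simps algebra_simps)
      thus ?thesis unfolding g using r by (intro mult_left_mono) auto
    qed
    note t = L_test[of g, OF dec lim]
    have eq: "(\<lambda>k. \<psi> (Suc k) / of_nat (Suc k) * of_real r ^ Suc k) = (\<lambda>k. \<psi> (Suc k) / of_nat (Suc k) - \<psi> (Suc k) * of_real (g k))"
      by (rule ext) (simp add: g_def divide_simps del: of_nat_Suc, simp add: algebra_simps)
    have "F r = L - (\<Sum>k. \<psi> (Suc k) * of_real (g k))"
      unfolding F_def L_def eq by (rule suminf_diff[OF L1_summable t(1), symmetric])
    hence "norm (F r - L) = norm (\<Sum>k. \<psi> (Suc k) * of_real (g k))" by simp
    also have "\<dots> \<le> real N * g 0" by (rule t(2))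
    finally show ?thesis by (simp add: g_def)
  qed
  have "((\<lambda>r. F r - L) \<longlongrightarrow> 0) (at_left 1)"
  proof (rule Lim_null_comparison)
    have "\<forall>\<^sub>F r in at_left (1::real). r \<in> {0<..<1}" by (rule eventually_at_left_real) simp
    thus "\<forall>\<^sub>F r in at_left 1. norm (F r - L) \<le> real N * (1 - r)" by eventually_elim (use F in auto)
    show "((\<lambda>r. real N * (1 - r)) \<longlongrightarrow> 0) (at_left 1)" by real_asymp
  qed
  hence "((\<lambda>r. F r - L + L) \<longlongrightarrow> 0 + L) (at_left 1)" by (intro tendsto_intros)
  hence "(F \<longlongrightarrow> L) (at_left 1)" by simp
  moreover have "(F \<longlongrightarrow> c) (at_left 1)" using lim by (simp add: F_def)
  ultimately show ?thesis unfolding L_def[symmetric] by (intro tendsto_unique) auto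
qed

end

text \<open>At s = 1 + e the Euler products force zeta^3 L(psi)^4 L(psi^2) to have modulus at least
  1. A zero at 1 would contribute a factor of order e^4 against e^(-3) from zeta. Non-reality makes
  psi^2 nonprincipal, so its L-series stays bounded.\<close>

theorem (in dirichlet_character) L1_nonzero:
  assumes nonreal: "\<exists>u. coprime u N \<and> \<psi> u ^ 2 \<noteq> 1"
  shows "(\<Sum>k. \<psi> (Suc k) / of_nat (Suc k)) \<noteq> 0"
proof
  assume zero: "(\<Sum>k. \<psi> (Suc k) / of_nat (Suc k)) = 0"
  obtain u where u: "coprime u N" "\<psi> u ^ 2 \<noteq> 1" using nonreal by blast
  hence u1: "\<psi> u \<noteq> 1" by auto
  interpret X: nonprincipal_character N \<psi> by unfold_locales (use u u1 in auto)
  interpret Y: nonprincipal_character N "\<lambda>a. \<psi> a ^ 2"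
    by unfold_locales (use u modulus_pos mult periodic eq_0_iff in \<open>auto simp: power_mult_distrib\<close>)
  \<comment> \<open>The final bound is (2/e)^3 (2Ne)^4 N = 128 N^5 e; this choice makes it
    1/2.\<close>
  define e where "e = 1 / (256 * real N ^ 5)"
  have N1: "real N \<ge> 1" using modulus_pos by simp
  hence N5: "real N ^ 5 \<ge> 1" by simp
  have "1 \<le> 256 * real N ^ 5" using N5 by linarith
  hence e: "e > 0" "e \<le> 1" unfolding e_def using modulus_pos by (auto simp: divide_simps)
  define q where "q = (\<lambda>k :: nat. real k powr - (1 + e))"
  define f1 where "f1 = (\<lambda>k. of_real (q k) :: complex)"
  define f2 where "f2 = (\<lambda>k. \<psi> k * of_real (q k))"
  define f3 where "f3 = (\<lambda>k. \<psi> k ^ 2 * of_real (q k))"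
  have q: "q 0 = 0" "q 1 = 1" "q (a * b) = q a * q b" "q a \<ge> 0" for a b
    using e by (auto simp: q_def powr_mult)
  have q1: "q p < 1" if "p > 1" for p
    unfolding q_def using that e powr_less_one[of "real p" "- (1 + e)"] by auto
  have sq: "summable q"
    using zeta_upper_bound(1)[OF e(1)] by (subst (asm) summable_Suc_iff) (simp add: q_def)
  have nf: "norm (f1 k) \<le> q k" "norm (f2 k) \<le> q k" "norm (f3 k) \<le> q k" for k
    using q(4) norm_le_1 by (auto simp: f1_def f2_def f3_def norm_mult norm_power intro!: mult_left_le_one_le power_le_one)
  have sf: "summable (\<lambda>k. norm (f1 k))" "summable (\<lambda>k. norm (f2 k))" "summable (\<lambda>k. norm (f3 k))"
    by (rule summable_comparison_test'[OF sq], use nf in simp)+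
  define Z L M where "Z = (\<Sum>k. f1 k)" and "L = (\<Sum>k. f2 k)" and "M = (\<Sum>k. f3 k)"
  define A where "A = (\<lambda>P :: nat. {p. prime p \<and> p \<le> P})"
  have eu: "(\<lambda>P. Z * (\<Prod>p\<in>A P. 1 - f1 p)) \<longlonglongrightarrow> 1" "(\<lambda>P. L * (\<Prod>p\<in>A P. 1 - f2 p)) \<longlonglongrightarrow> 1"
    "(\<lambda>P. M * (\<Prod>p\<in>A P. 1 - f3 p)) \<longlonglongrightarrow> 1"
    unfolding Z_def L_def M_def A_def
    by (intro euler_product sf; use q mult in \<open>simp add: f1_def f2_def f3_def power_mult_distrib\<close>)+
  have "(\<lambda>P. norm (Z * (\<Prod>p\<in>A P. 1 - f1 p)) ^ 3 * norm (L * (\<Prod>p\<in>A P. 1 - f2 p)) ^ 4 * norm (M * (\<Prod>p\<in>A P. 1 - f3 p)))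
    \<longlonglongrightarrow> norm (1 :: complex) ^ 3 * norm (1 :: complex) ^ 4 * norm (1 :: complex)"
    by (intro tendsto_intros eu)
  moreover have "norm (Z * (\<Prod>p\<in>A P. 1 - f1 p)) ^ 3 * norm (L * (\<Prod>p\<in>A P. 1 - f2 p)) ^ 4 * norm (M * (\<Prod>p\<in>A P. 1 - f3 p))
    \<le> norm Z ^ 3 * norm L ^ 4 * norm M" (is "?l P \<le> ?r") for P
  proof -
    have "?l P = ?r * (\<Prod>p\<in>A P. norm (1 - f1 p) ^ 3 * norm (1 - f2 p) ^ 4 * norm (1 - f3 p))"
      by (simp add: norm_mult power_mult_distrib prod_norm[symmetric] prod.distrib prod_power_distrib)
    also have "\<dots> \<le> ?r * 1"
    proof (intro mult_left_mono prod_le_1 conjI)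
      fix p assume "p \<in> A P"
      hence p: "p > 1" using prime_gt_1_nat[of p] by (simp add: A_def)
      have "norm (1 - f1 p) = 1 - q p"
        unfolding f1_def using q1[OF p] by (metis abs_of_pos diff_gt_0_iff_gt norm_of_real of_real_1 of_real_diff)
      moreover have "\<psi> p = 0 \<or> norm (\<psi> p) = 1" using eq_0_iff norm_eq_1 by blast
      ultimately show "norm (1 - f1 p) ^ 3 * norm (1 - f2 p) ^ 4 * norm (1 - f3 p) \<le> 1"
        using three_four_one[OF q(4) q1[OF p], of "\<psi> p"] by (simp add: f2_def f3_def mult.commute)
    qed auto
    finally show ?thesis by simp
  qed
  ultimately have "norm (1 :: complex) ^ 3 * norm (1 :: complex) ^ 4 * norm (1 :: complex) \<le> norm Z ^ 3 * norm L ^ 4 * norm M"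
    by (intro LIMSEQ_le_const2) auto
  hence ge: "1 \<le> norm Z ^ 3 * norm L ^ 4 * norm M" by simp
  have head: "suminf f = (\<Sum>k. f (Suc k))" if "summable (\<lambda>k. norm (f k))" "f 0 = 0" for f :: "nat \<Rightarrow> complex"
    using suminf_split_head[OF summable_norm_cancel[OF that(1)]] that(2) by simp
  have "Z = of_real (\<Sum>k. q k)" unfolding Z_def f1_def by (rule suminf_of_real[OF sq, symmetric])
  hence "norm Z = \<bar>\<Sum>k. q k\<bar>" by simp
  also have "\<dots> = (\<Sum>k. q (Suc k))"
    using suminf_nonneg[OF sq] q suminf_split_head[OF sq] by simp
  also have "\<dots> \<le> 1 + 1 / e" unfolding q_def by (rule zeta_upper_bound(2)[OF e(1)])
  also have "\<dots> \<le> 2 / e" using e by (simp add: field_simps)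
  finally have Z: "norm Z \<le> 2 / e" .
  have L: "norm L \<le> 2 * real N * e"
    using X.L_near_1[OF e(1)] zero head[OF sf(2)] q by (simp add: L_def f2_def q_def)
  have M: "norm M \<le> real N"
    using Y.L_bound[of "1 + e"] e head[OF sf(3)] q by (simp add: M_def f3_def q_def)
  have "norm Z ^ 3 * norm L ^ 4 * norm M \<le> (2 / e) ^ 3 * (2 * real N * e) ^ 4 * real N"
    by (intro mult_mono power_mono Z L M) (use e in auto)
  also have "\<dots> = 128 * real N ^ 5 * e" using e by (simp add: field_simps power_numeral_reduce)
  also have "\<dots> = 1 / 2" using N1 by (simp add: e_def)
  finally show False using ge by simp
qed

section \<open>Gauss sums and cyclotomic logarithms\<close>

lemma cis_2pi_power_eq_iff:
  assumes "N > 0"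
  shows "cis (2 * pi / real N) ^ a = cis (2 * pi / real N) ^ b \<longleftrightarrow> [a = b] (mod N)"
proof -
  have p: "cis (2 * pi / real N) ^ m = exp (2 * of_real pi * \<i> * of_nat m / of_nat N)" for m
    by (simp only: Complex.DeMoivre) (simp add: cis_conv_exp field_simps)
  show ?thesis unfolding p using complex_root_unity_eq[of N a b] assms
    by (simp add: unique_euclidean_semiring_class.cong_def)
qed

text \<open>The congruence u k = k modulo N says u = 1 modulo N / gcd(k, N). So the character must
  be nontrivial on each of these kernels, that is, it is not induced from a proper divisor of N.
  This is the form in which Gauss sums use primitivity.\<close>

locale primitive_character = dirichlet_character +
  assumes modulus_gt_1: "N > 1"
    and primitive: "\<not> coprime k N \<Longrightarrow> \<exists>u. coprime u N \<and> [u * k = k] (mod N) \<and> \<psi> u \<noteq> 1"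
begin

definition \<zeta> :: complex where "\<zeta> = cis (2 * pi / real N)"

lemma zeta_eq_iff: "\<zeta> ^ a = \<zeta> ^ b \<longleftrightarrow> [a = b] (mod N)"
  unfolding \<zeta>_def by (rule cis_2pi_power_eq_iff[OF modulus_pos])

lemma zeta_mod: "\<zeta> ^ (a mod N) = \<zeta> ^ a"
  by (simp add: zeta_eq_iff unique_euclidean_semiring_class.cong_def)

lemma norm_zeta: "norm (\<zeta> ^ a) = 1"
  by (simp add: \<zeta>_def norm_power)

lemma zeta_mult_cnj: "\<zeta> ^ a * cnj (\<zeta> ^ a) = 1"
  using norm_zeta[of a] by (metis complex_norm_square of_real_1 one_power2)

definition gauss_sum :: "nat \<Rightarrow> complex" where
  "gauss_sum k = (\<Sum>a<N. \<psi> a * \<zeta> ^ (a * k))"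

lemma gauss_sum_mult: "\<psi> u * (\<Sum>a<N. \<psi> a * \<zeta> ^ (u * a * k)) = gauss_sum k" if u: "coprime u N"
proof -
  have "gauss_sum k = (\<Sum>a<N. \<psi> (u * a mod N) * \<zeta> ^ ((u * a mod N) * k))"
    unfolding gauss_sum_def by (rule sum_mod_reindex[OF u, symmetric])
  also have "\<dots> = (\<Sum>a<N. \<psi> u * (\<psi> a * \<zeta> ^ (u * a * k)))"
    by (rule sum.cong) (simp_all add: mod_modulus mult power_mult zeta_mod mult.assoc)
  finally show ?thesis by (simp add: sum_distrib_left)
qed

text \<open>For k coprime to N, substitute a -> k a in the sum at 1. Otherwise a unit u that fixes k
  and has \<open>\<psi> u \<noteq> 1\<close> shows that the sum at k equals \<open>\<psi> u\<close>
  times itself, so it vanishes.\<close>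

lemma gauss_sum_eq: "gauss_sum k = cnj (\<psi> k) * gauss_sum 1"
proof (cases "coprime k N")
  case True
  have "gauss_sum 1 = \<psi> k * gauss_sum k"
    unfolding gauss_sum_def[of k] using gauss_sum_mult[OF True, of 1] by (simp only: mult.commute[of k] mult_1_right)
  hence "cnj (\<psi> k) * gauss_sum 1 = (cnj (\<psi> k) * \<psi> k) * gauss_sum k" by simp
  thus ?thesis by (simp only: cnj_mult_self[OF True] mult_1)
next
  case False
  then obtain u where u: "coprime u N" "[u * k = k] (mod N)" "\<psi> u \<noteq> 1" using primitive by blast
  have "\<zeta> ^ (u * a * k) = \<zeta> ^ (a * k)" for a
    unfolding zeta_eq_iff using cong_scalar_left[OF u(2), of a] by (simp add: mult_ac)
  hence "\<psi> u * gauss_sum k = gauss_sum k"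
    using gauss_sum_mult[OF u(1), of k] by (simp add: gauss_sum_def)
  hence "gauss_sum k = 0" using u(3) by simp
  thus ?thesis using False eq_0_iff by simp
qed

text \<open>If it vanished, so would every \<open>gauss_sum k\<close>, and Fourier inversion at the
  residue 1 would give N = 0.\<close>

lemma gauss_sum_nonzero: "gauss_sum 1 \<noteq> 0"
proof
  assume "gauss_sum 1 = 0"
  hence 0: "gauss_sum k = 0" for k using gauss_sum_eq[of k] by simp
  have inner: "(\<Sum>k<N. \<zeta> ^ (a * k) * cnj (\<zeta> ^ k)) = (if a = 1 then of_nat N else 0)" if "a < N" for a
  proof -
    define w where "w = \<zeta> ^ a * cnj \<zeta>"
    have "(\<Sum>k<N. \<zeta> ^ (a * k) * cnj (\<zeta> ^ k)) = (\<Sum>k<N. w ^ k)"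
      by (simp add: w_def power_mult_distrib power_mult)
    also have "\<dots> = (if a = 1 then of_nat N else 0)"
    proof (cases "a = 1")
      case True
      thus ?thesis using zeta_mult_cnj[of 1] by (simp add: w_def)
    next
      case False
      have "\<zeta> ^ a \<noteq> \<zeta> ^ 1"
        unfolding zeta_eq_iff using that False modulus_gt_1 by (simp add: unique_euclidean_semiring_class.cong_def)
      moreover have "\<zeta> ^ a = w * \<zeta> ^ 1" using zeta_mult_cnj[of 1] by (simp add: w_def mult.assoc mult.commute[of "cnj \<zeta>"])
      ultimately have "w \<noteq> 1" by auto
      moreover have "\<zeta> ^ N = 1" using zeta_mod[of N] by simp
      hence "w ^ N = 1" 
        by (metis (no_types, lifting) complex_cnj_one complex_cnj_power mult.commute mult.right_neutral power_mult power_mult_distrib power_one w_def)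
      ultimately show ?thesis using False by (simp add: geometric_sum)
    qed
    finally show ?thesis .
  qed
  have "0 = (\<Sum>k<N. gauss_sum k * cnj (\<zeta> ^ k))" by (simp add: 0)
  also have "\<dots> = (\<Sum>k<N. \<Sum>a<N. \<psi> a * (\<zeta> ^ (a * k) * cnj (\<zeta> ^ k)))"
    by (simp add: gauss_sum_def sum_distrib_right mult.assoc)
  also have "\<dots> = (\<Sum>a<N. \<Sum>k<N. \<psi> a * (\<zeta> ^ (a * k) * cnj (\<zeta> ^ k)))" by (rule sum.swap)
  also have "\<dots> = (\<Sum>a<N. \<psi> a * (if a = 1 then of_nat N else 0))"
  proof (rule sum.cong[OF refl])
    fix a assume "a \<in> {..<N}"
    hence "a < N" by simp
    thus "(\<Sum>k<N. \<psi> a * (\<zeta> ^ (a * k) * cnj (\<zeta> ^ k))) = \<psi> a * (if a = 1 then of_nat N else 0)"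
      by (simp only: sum_distrib_left[symmetric] inner)
  qed
  also have "\<dots> = of_nat N" using modulus_gt_1 by (simp add: if_distrib sum.delta cong: if_cong)
  finally show False using modulus_pos by simp
qed

lemma conj_character: "dirichlet_character N (\<lambda>a. cnj (\<psi> a))"
  by unfold_locales (auto simp: modulus_pos mult periodic eq_0_iff)

text \<open>Expanding Ln (1 - r \<zeta>^a) in powers of r and summing over a turns Gauss sums into -
  \<open>gauss_sum 1\<close> times the series of the conjugate character with weights r^k / k;
  Abel's theorem gives L(1) in the limit. Evenness pairs a with -a, whose logarithms are complex
  conjugates, and this replaces Ln by ln of the modulus.\<close>

theorem sum_ln_nonzero:
  assumes even: "\<psi> (N - 1) = 1" and nonreal: "\<exists>u. coprime u N \<and> \<psi> u ^ 2 \<noteq> 1"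
  shows "(\<Sum>a<N. \<psi> a * of_real (ln (norm (1 - \<zeta> ^ a)))) \<noteq> 0"
proof
  assume zero: "(\<Sum>a<N. \<psi> a * of_real (ln (norm (1 - \<zeta> ^ a)))) = 0"
  have nonreal': "\<exists>u. coprime u N \<and> cnj (\<psi> u) ^ 2 \<noteq> 1"
    using nonreal by (metis complex_cnj_cnj complex_cnj_one complex_cnj_power)
  interpret C: dirichlet_character N "\<lambda>a. cnj (\<psi> a)" by (rule conj_character)
  interpret C: nonprincipal_character N "\<lambda>a. cnj (\<psi> a)"
    by unfold_locales (use nonreal' in fastforce)
  \<comment> \<open>Positive real part keeps 1 - \<zeta>^a off the branch cut of Ln. Both the limit
    r -> 1 and the compatibility of Ln with conjugation rest on this.\<close>
  have Re_pos: "Re (1 - \<zeta> ^ a) > 0" if "coprime a N" for a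
  proof -
    have "\<not> [a = 0] (mod N)" using that modulus_gt_1 by (auto simp: cong_0_iff coprime_absorb_right)
    hence "\<zeta> ^ a \<noteq> 1" using zeta_eq_iff[of a 0] by simp
    moreover have "Re (\<zeta> ^ a) \<le> 1" using complex_Re_le_cmod[of "\<zeta> ^ a"] by (simp add: norm_zeta)
    moreover have "\<zeta> ^ a = 1" if "Re (\<zeta> ^ a) = 1"
      using that norm_zeta[of a] by (auto simp: cmod_def complex_eq_iff)
    ultimately show ?thesis by force
  qed
  define F where "F = (\<lambda>r :: real. \<Sum>a<N. \<psi> a * Ln (1 - of_real r * \<zeta> ^ a))"
  define T where "T = (\<Sum>a<N. \<psi> a * Ln (1 - \<zeta> ^ a))"
  have "(F \<longlongrightarrow> (\<Sum>a<N. \<psi> a * Ln (1 - of_real 1 * \<zeta> ^ a))) (at_left 1)"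
    unfolding F_def
  proof (rule tendsto_sum)
    fix a
    show "((\<lambda>r. \<psi> a * Ln (1 - of_real r * \<zeta> ^ a)) \<longlongrightarrow> \<psi> a * Ln (1 - of_real 1 * \<zeta> ^ a)) (at_left 1)"
    proof (cases "coprime a N")
      case True
      have "1 - of_real 1 * \<zeta> ^ a \<notin> \<real>\<^sub>\<le>\<^sub>0" using Re_pos[OF True] by (auto simp: complex_nonpos_Reals_iff)
      thus ?thesis by (intro tendsto_intros)
    next
      case False
      hence "\<psi> a = 0" using eq_0_iff by simp
      thus ?thesis by simp
    qed
  qed
  hence lim: "(F \<longlongrightarrow> T) (at_left 1)" by (simp add: T_def)
  have cop: "coprime (N - 1) N" by (rule coprime_diff_one_left_nat[OF modulus_pos])
  have "T = (\<Sum>a<N. \<psi> ((N - 1) * a mod N) * Ln (1 - \<zeta> ^ ((N - 1) * a mod N)))"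
    unfolding T_def by (rule sum_mod_reindex[OF cop, symmetric])
  also have "\<dots> = (\<Sum>a<N. \<psi> a * cnj (Ln (1 - \<zeta> ^ a)))"
  proof (rule sum.cong[OF refl])
    fix a assume "a \<in> {..<N}"
    show "\<psi> ((N - 1) * a mod N) * Ln (1 - \<zeta> ^ ((N - 1) * a mod N)) = \<psi> a * cnj (Ln (1 - \<zeta> ^ a))"
    proof (cases "coprime a N")
      case True
      have "(N - 1) * a + a = N * a" using modulus_pos by (simp add: algebra_simps)
      hence "\<zeta> ^ ((N - 1) * a) * \<zeta> ^ a = \<zeta> ^ 0" unfolding power_add[symmetric] zeta_eq_iff by (simp add: cong_0_iff)
      hence "\<zeta> ^ ((N - 1) * a) * (\<zeta> ^ a * cnj (\<zeta> ^ a)) = cnj (\<zeta> ^ a)" by (simp add: mult.assoc[symmetric])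
      hence "\<zeta> ^ ((N - 1) * a) = cnj (\<zeta> ^ a)" unfolding zeta_mult_cnj by simp
      moreover have "1 - \<zeta> ^ a \<notin> \<real>\<^sub>\<le>\<^sub>0" using Re_pos[OF True] by (auto simp: complex_nonpos_Reals_iff)
      ultimately show ?thesis by (simp add: zeta_mod mod_modulus mult even[unfolded One_nat_def] cnj_Ln)
    next
      case False
      thus ?thesis using eq_0_iff by (simp add: mod_modulus mult)
    qed
  qed
  finally have "T + T = (\<Sum>a<N. \<psi> a * Ln (1 - \<zeta> ^ a)) + (\<Sum>a<N. \<psi> a * cnj (Ln (1 - \<zeta> ^ a)))"
    by (simp only: T_def)
  also have "\<dots> = (\<Sum>a<N. 2 * (\<psi> a * of_real (ln (norm (1 - \<zeta> ^ a)))))"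
    unfolding sum.distrib[symmetric]
  proof (rule sum.cong[OF refl])
    fix a
    show "\<psi> a * Ln (1 - \<zeta> ^ a) + \<psi> a * cnj (Ln (1 - \<zeta> ^ a)) = 2 * (\<psi> a * of_real (ln (norm (1 - \<zeta> ^ a))))"
    proof (cases "coprime a N")
      case True
      hence "1 - \<zeta> ^ a \<noteq> 0" using Re_pos[OF True] by force
      hence "Ln (1 - \<zeta> ^ a) + cnj (Ln (1 - \<zeta> ^ a)) = of_real (2 * ln (norm (1 - \<zeta> ^ a)))"
        unfolding complex_add_cnj by simp
      thus ?thesis by (simp only: distrib_left[symmetric]) simp
    next
      case False
      hence "\<psi> a = 0" using eq_0_iff by simp
      thus ?thesis by simp
    qed
  qed
  also have "\<dots> = 0" using zero by (simp flip: sum_distrib_left)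
  finally have T0: "T = 0" by simp
  have F: "F r = - gauss_sum 1 * (\<Sum>k. cnj (\<psi> (Suc k)) / of_nat (Suc k) * of_real r ^ Suc k)"
    if r: "0 < r" "r < 1" for r :: real
  proof -
    have "(\<lambda>k. \<psi> a * (- ((of_real r * \<zeta> ^ a) ^ k) / of_nat k)) sums (\<psi> a * Ln (1 - of_real r * \<zeta> ^ a))" for a
    proof -
      have "norm (- (of_real r * \<zeta> ^ a)) < 1" using r by (simp add: norm_mult norm_zeta)
      from Ln_series'[OF this] show ?thesis by (intro sums_mult) simp
    qed
    hence "(\<lambda>k. \<Sum>a<N. \<psi> a * (- ((of_real r * \<zeta> ^ a) ^ k) / of_nat k)) sums F r"
      unfolding F_def by (intro sums_sum)
    also have "(\<lambda>k. \<Sum>a<N. \<psi> a * (- ((of_real r * \<zeta> ^ a) ^ k) / of_nat k)) = (\<lambda>k. - gauss_sum 1 * (cnj (\<psi> k) / of_nat k * of_real r ^ k))"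
    proof
      fix k
      have "(\<Sum>a<N. \<psi> a * (- ((of_real r * \<zeta> ^ a) ^ k) / of_nat k)) = (\<Sum>a<N. - (of_real r ^ k / of_nat k) * (\<psi> a * \<zeta> ^ (a * k)))"
        by (rule sum.cong) (simp_all add: power_mult_distrib power_mult)
      also have "\<dots> = - (of_real r ^ k / of_nat k) * gauss_sum k" by (simp add: gauss_sum_def sum_distrib_left)
      also have "\<dots> = - gauss_sum 1 * (cnj (\<psi> k) / of_nat k * of_real r ^ k)"
        by (subst gauss_sum_eq) simp
      finally show "(\<Sum>a<N. \<psi> a * (- ((of_real r * \<zeta> ^ a) ^ k) / of_nat k)) = - gauss_sum 1 * (cnj (\<psi> k) / of_nat k * of_real r ^ k)" .
    qed
    finally have "(\<lambda>k. - gauss_sum 1 * (cnj (\<psi> (Suc k)) / of_nat (Suc k) * of_real r ^ Suc k)) sums F r"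
      by (subst sums_Suc_iff) simp
    hence "F r = (\<Sum>k. - gauss_sum 1 * (cnj (\<psi> (Suc k)) / of_nat (Suc k) * of_real r ^ Suc k))" 
      and s: "summable (\<lambda>k. - gauss_sum 1 * (cnj (\<psi> (Suc k)) / of_nat (Suc k) * of_real r ^ Suc k))"
      by (simp_all only: sums_iff)
    moreover have "summable (\<lambda>k. cnj (\<psi> (Suc k)) / of_nat (Suc k) * of_real r ^ Suc k)"
      using s gauss_sum_nonzero by (subst (asm) summable_cmult_iff) simp
    ultimately show ?thesis by (simp only: suminf_mult)
  qed
  have "((\<lambda>r. F r / (- gauss_sum 1)) \<longlongrightarrow> T / (- gauss_sum 1)) (at_left 1)"
    by (intro tendsto_intros lim) (use gauss_sum_nonzero in simp)
  moreover have "\<forall>\<^sub>F r in at_left (1::real). r \<in> {0<..<1}" by (rule eventually_at_left_real) simp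
  hence "\<forall>\<^sub>F r in at_left (1::real). F r / (- gauss_sum 1) = (\<Sum>k. cnj (\<psi> (Suc k)) / of_nat (Suc k) * of_real r ^ Suc k)"
    by eventually_elim (use F gauss_sum_nonzero in \<open>simp del: power_Suc of_nat_Suc\<close>)
  ultimately have "((\<lambda>r. \<Sum>k. cnj (\<psi> (Suc k)) / of_nat (Suc k) * of_real r ^ Suc k) \<longlongrightarrow> T / (- gauss_sum 1)) (at_left (1::real))"
    by (rule Lim_transform_eventually)
  hence "(\<Sum>k. cnj (\<psi> (Suc k)) / of_nat (Suc k)) = T / (- gauss_sum 1)" by (rule C.abel_limit)
  thus False using C.L1_nonzero[OF nonreal'] T0 by simp
qed

end

section \<open>A family of primitive characters\<close>

text \<open>A generator of the character group modulo the prime p, together with a primitive root g,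
  at which its value has exact order p - 1. The other characters modulo p are its powers.\<close>

definition generating_character :: "nat \<Rightarrow> (nat \<Rightarrow> complex) \<Rightarrow> nat \<Rightarrow> bool" where
  "generating_character p \<psi> g \<longleftrightarrow>
    (\<forall>a b. \<psi> (a * b) = \<psi> a * \<psi> b) \<and> (\<forall>a b. [a = b] (mod p) \<longrightarrow> \<psi> a = \<psi> b) \<and>
    (\<forall>a. \<psi> a = 0 \<longleftrightarrow> p dvd a) \<and> (\<forall>a. \<psi> a = 1 \<longrightarrow> [a = 1] (mod p)) \<and>
    (\<forall>a. \<not> p dvd a \<longrightarrow> \<psi> a ^ (p - 1) = 1) \<and> \<not> p dvd g \<and> (\<forall>k. \<psi> g ^ k = 1 \<longleftrightarrow> (p - 1) dvd k)"

text \<open>The character is the discrete logarithm to a primitive root followed by k -> w^k. The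
  exponent \<open>ind a\<close> is an arbitrary choice; its effect is well defined because
  \<open>w\<close> and \<open>g\<close> have the same order p - 1.\<close>

lemma prime_generating_character:
  assumes p: "prime p"
  shows "\<exists>\<psi> g. generating_character p \<psi> g"
proof -
  have p1: "p > 1" using p prime_gt_1_nat by blast
  obtain g where g: "residue_primroot p g"
    using prime_primitive_root_exists[OF p1 p] by blast
  have tot: "totient p = p - 1" using p by (rule totient_prime)
  have g': "coprime p g" "ord p g = p - 1" using g tot by (auto simp: residue_primroot_def)
  have cop: "coprime a p \<longleftrightarrow> \<not> p dvd a" for a
    using prime_imp_coprime[OF p, of a] p1 by (auto simp: coprime_commute coprime_absorb_left)
  have gpow: "[g ^ i = g ^ j] (mod p) \<longleftrightarrow> [i = j] (mod p - 1)" for i j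
    using order_divides_expdiff[OF g'(1)] g'(2) by simp
  have "\<exists>k. [g ^ k = a] (mod p)" if "\<not> p dvd a" for a
  proof -
    have "a mod p > 0" using that by (simp add: dvd_eq_mod_eq_0)
    moreover have "coprime (a mod p) p" unfolding cop using that by (simp add: dvd_mod_iff)
    ultimately have "a mod p \<in> totatives p" using p1 by (simp add: totatives_def less_imp_le)
    then obtain k where "g ^ k mod p = a mod p"
      using residue_primroot_is_generator[OF p1 g] unfolding bij_betw_def by force
    thus ?thesis by (auto simp: unique_euclidean_semiring_class.cong_def)
  qed
  then obtain ind where ind: "\<And>a. \<not> p dvd a \<Longrightarrow> [g ^ ind a = a] (mod p)" by metis
  define w where "w = cis (2 * pi / real (p - 1))"
  have w: "w ^ i = w ^ j \<longleftrightarrow> [i = j] (mod p - 1)" for i j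
    unfolding w_def by (rule cis_2pi_power_eq_iff) (use p1 in simp)
  have w0: "w ^ i \<noteq> 0" for i by (simp add: w_def)
  define \<psi> where "\<psi> = (\<lambda>a. if p dvd a then 0 else w ^ ind a)"
  have psi: "\<psi> a = w ^ i \<longleftrightarrow> [a = g ^ i] (mod p)" if "\<not> p dvd a" for a i
  proof -
    have "\<psi> a = w ^ i \<longleftrightarrow> [g ^ ind a = g ^ i] (mod p)" using that by (simp add: \<psi>_def w gpow)
    also have "\<dots> \<longleftrightarrow> [a = g ^ i] (mod p)"
      using ind[OF that] by (simp add: unique_euclidean_semiring_class.cong_def)
    finally show ?thesis .
  qed
  have mult: "\<psi> (a * b) = \<psi> a * \<psi> b" for a b
  proof (cases "p dvd a \<or> p dvd b")
    case False
    hence "\<not> p dvd a * b" using p by (simp add: prime_dvd_mult_iff)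
    moreover have "[a * b = g ^ (ind a + ind b)] (mod p)"
      unfolding power_add by (intro cong_mult) (use False ind cong_sym in auto)
    ultimately have "\<psi> (a * b) = w ^ (ind a + ind b)" using psi by blast
    thus ?thesis using False by (simp add: \<psi>_def power_add)
  qed (auto simp: \<psi>_def)
  have cong: "\<psi> a = \<psi> b" if ab: "[a = b] (mod p)" for a b
  proof (cases "p dvd a")
    case True
    thus ?thesis using cong_dvd_iff[OF ab] by (simp add: \<psi>_def)
  next
    case False
    hence "\<not> p dvd b" using cong_dvd_iff[OF ab] by simp
    have "\<psi> a = w ^ ind b" unfolding psi[OF False]
      by (rule cong_trans[OF ab cong_sym[OF ind[OF \<open>\<not> p dvd b\<close>]]])
    thus ?thesis using \<open>\<not> p dvd b\<close> by (simp add: \<psi>_def)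
  qed
  have pg: "\<not> p dvd g" using g'(1) cop by (simp add: coprime_commute)
  have "[g = g ^ 1] (mod p)" by simp
  hence psig: "\<psi> g = w ^ 1" using psi[OF pg, of 1] by blast
  have wp: "w ^ k = 1 \<longleftrightarrow> (p - 1) dvd k" for k
    using w[of k 0] by (simp add: cong_0_iff)
  show ?thesis
    unfolding generating_character_def
  proof (intro exI[of _ \<psi>] exI[of _ g] conjI allI impI)
    fix a assume a: "\<psi> a = 1"
    hence "\<not> p dvd a" by (auto simp: \<psi>_def)
    thus "[a = 1] (mod p)" using psi[of a 0] a by simp
  next
    fix a assume "\<not> p dvd a"
    hence "\<psi> a ^ (p - 1) = w ^ (ind a * (p - 1))" by (simp add: \<psi>_def power_mult)
    thus "\<psi> a ^ (p - 1) = 1" by (simp add: wp)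
  qed (use mult cong pg w0 wp psig in \<open>auto simp: \<psi>_def\<close>)
qed

text \<open>A relation between the translates of \<open>h\<close> is inherited by the values of every character
  with nonzero Fourier coefficient at \<open>h\<close>.\<close>

lemma (in dirichlet_character) translate_relation:
  fixes h :: "nat \<Rightarrow> real" and c :: "nat \<Rightarrow> real"
  assumes per: "\<And>k. h (k mod N) = h k" and nz: "(\<Sum>b<N. \<psi> b * of_real (h b)) \<noteq> 0"
    and fin: "finite I" and cop: "\<And>i. i \<in> I \<Longrightarrow> coprime (a i) N"
    and rel: "\<And>b. coprime b N \<Longrightarrow> (\<Sum>i\<in>I. c i * h (a i * b)) = 0"
  shows "(\<Sum>i\<in>I. of_real (c i) * \<psi> (a i)) = 0"
proof -
  define T where "T = (\<Sum>b<N. \<psi> b * of_real (h b))"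
  \<comment> \<open>Substituting b -> u b turns the translate by u into the factor
    \<open>cnj (\<psi> u)\<close>, so the relation first comes out conjugated.\<close>
  have tr: "(\<Sum>b<N. \<psi> b * of_real (h (u * b))) = cnj (\<psi> u) * T" if u: "coprime u N" for u
  proof -
    have "T = (\<Sum>b<N. \<psi> (u * b mod N) * of_real (h (u * b mod N)))"
      unfolding T_def by (rule sum_mod_reindex[OF u, symmetric])
    also have "\<dots> = \<psi> u * (\<Sum>b<N. \<psi> b * of_real (h (u * b)))"
      by (simp add: mod_modulus mult per sum_distrib_left mult.assoc)
    finally have "cnj (\<psi> u) * T = (cnj (\<psi> u) * \<psi> u) * (\<Sum>b<N. \<psi> b * of_real (h (u * b)))"
      by (simp only: mult.assoc)
    thus ?thesis by (simp add: cnj_mult_self[OF u])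
  qed
  have "0 = (\<Sum>b<N. \<psi> b * of_real (\<Sum>i\<in>I. c i * h (a i * b)))"
  proof (rule sum.neutral[symmetric], rule ballI)
    fix b
    show "\<psi> b * of_real (\<Sum>i\<in>I. c i * h (a i * b)) = 0"
      using rel[of b] eq_0_iff[of b] by (cases "coprime b N") auto
  qed
  also have "\<dots> = (\<Sum>b<N. \<Sum>i\<in>I. of_real (c i) * (\<psi> b * of_real (h (a i * b))))"
    by (simp add: sum_distrib_left mult_ac)
  also have "\<dots> = (\<Sum>i\<in>I. \<Sum>b<N. of_real (c i) * (\<psi> b * of_real (h (a i * b))))" by (rule sum.swap)
  also have "\<dots> = (\<Sum>i\<in>I. of_real (c i) * cnj (\<psi> (a i)) * T)"
    by (rule sum.cong) (simp_all add: cop tr mult.assoc flip: sum_distrib_left)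
  also have "\<dots> = cnj (\<Sum>i\<in>I. of_real (c i) * \<psi> (a i)) * T" by (simp add: sum_distrib_right)
  finally have "cnj (\<Sum>i\<in>I. of_real (c i) * \<psi> (a i)) = 0" using nz by (simp add: T_def del: cnj_sum)
  thus ?thesis by (simp only: complex_cnj_zero_iff)
qed

text \<open>Translation by u changes the sign of the sum, so the difference has twice the transform.
  It is applied with u = 1 + 2n, where the difference of logarithms is that of a tangent.\<close>

lemma (in primitive_character) sum_ln_difference_nonzero:
  assumes "\<psi> (N - 1) = 1" and "\<exists>u. coprime u N \<and> \<psi> u ^ 2 \<noteq> 1" and u: "\<psi> u = - 1"
  shows "(\<Sum>a<N. \<psi> a * of_real (ln (norm (1 - \<zeta> ^ a)) - ln (norm (1 - \<zeta> ^ (u * a))))) \<noteq> 0"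
proof -
  define T where "T = (\<Sum>a<N. \<psi> a * of_real (ln (norm (1 - \<zeta> ^ a))))"
  have cop: "coprime u N" using u eq_0_iff[of u] by auto
  have "T = (\<Sum>a<N. \<psi> (u * a mod N) * of_real (ln (norm (1 - \<zeta> ^ (u * a mod N)))))"
    unfolding T_def by (rule sum_mod_reindex[OF cop, symmetric])
  also have "\<dots> = - (\<Sum>a<N. \<psi> a * of_real (ln (norm (1 - \<zeta> ^ (u * a)))))"
    by (simp add: mod_modulus mult zeta_mod u sum_negf)
  finally have "(\<Sum>a<N. \<psi> a * of_real (ln (norm (1 - \<zeta> ^ (u * a))))) = - T" by simp
  hence "(\<Sum>a<N. \<psi> a * of_real (ln (norm (1 - \<zeta> ^ a)) - ln (norm (1 - \<zeta> ^ (u * a))))) = 2 * T"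
    by (simp add: right_diff_distrib sum_subtractf T_def)
  thus ?thesis using sum_ln_nonzero[OF assms(1,2)] by (simp add: T_def)
qed

section \<open>The character modulo 4 and its products with characters modulo primes\<close>

definition chi4 :: "nat \<Rightarrow> complex" where
  "chi4 a = (if even a then 0 else if a mod 4 = 1 then 1 else - 1)"

lemma coprime_4_iff_odd: "coprime a (4 :: nat) \<longleftrightarrow> odd a"
proof -
  have "coprime a (2 ^ 2) \<longleftrightarrow> odd a"
    by (simp only: coprime_power_right_iff coprime_right_2_iff_odd) simp
  thus ?thesis by simp
qed

lemma chi4_mult: "chi4 (a * b) = chi4 a * chi4 b"
proof -
  have "a mod 4 \<in> {0,1,2,3}" "b mod 4 \<in> {0,1,2,3}" by auto
  moreover have "a * b mod 4 = (a mod 4) * (b mod 4) mod 4" by (simp add: mod_mult_eq)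
  moreover have "even a \<longleftrightarrow> even (a mod 4)" "even b \<longleftrightarrow> even (b mod 4)" by presburger+
  ultimately show ?thesis by (auto simp: chi4_def)
qed

lemma chi4_cong: "[a = b] (mod 4) \<Longrightarrow> chi4 a = chi4 b"
proof -
  assume "[a = b] (mod 4)"
  hence "a mod 4 = b mod 4" by (simp add: unique_euclidean_semiring_class.cong_def)
  moreover from this have "even a \<longleftrightarrow> even b" by presburger
  ultimately show ?thesis by (simp add: chi4_def)
qed

locale character_family =
  fixes P :: "nat set" and q :: nat and n :: nat and \<Psi> :: "nat \<Rightarrow> nat \<Rightarrow> complex" and g :: "nat \<Rightarrow> nat"
  assumes fin: "finite P" and primes: "\<And>p. p \<in> P \<Longrightarrow> prime p" and ge13: "\<And>p. p \<in> P \<Longrightarrow> p \<ge> 13"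
    and q: "q \<in> P" "q \<ge> 17" and other: "P \<noteq> {q}" and n_eq: "n = \<Prod>P"
    and gen: "\<And>p. p \<in> P \<Longrightarrow> generating_character p (\<Psi> p) (g p)"
begin

lemma
  assumes "p \<in> P"
  shows Psi_mult: "\<Psi> p (a * b) = \<Psi> p a * \<Psi> p b"
    and Psi_cong: "[a = b] (mod p) \<Longrightarrow> \<Psi> p a = \<Psi> p b"
    and Psi_0: "\<Psi> p a = 0 \<longleftrightarrow> p dvd a"
    and Psi_1: "\<Psi> p a = 1 \<Longrightarrow> [a = 1] (mod p)"
    and Psi_order: "\<not> p dvd a \<Longrightarrow> \<Psi> p a ^ (p - 1) = 1"
    and g: "\<not> p dvd g p"
    and Psi_g: "\<Psi> p (g p) ^ k = 1 \<longleftrightarrow> (p - 1) dvd k"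
  using gen[OF assms] unfolding generating_character_def by blast+

text \<open>All exponents are nonzero, so the product characters are primitive. Leaving out the quadratic
  exponent at \<open>q\<close> keeps them non-real, so that only the easy case of \<open>L(1, \<chi>) \<noteq> 0\<close> is needed.\<close>

definition J :: "nat \<Rightarrow> nat set" where
  "J p = (if p = q then {1..<p - 1} - {(p - 1) div 2} else {1..<p - 1})"

definition X :: "(nat \<Rightarrow> nat) \<Rightarrow> nat \<Rightarrow> complex" where
  "X j a = chi4 a * (\<Prod>p\<in>P. \<Psi> p a ^ j p)"

lemma n_pos: "n > 0"
  unfolding n_eq using fin primes by (intro prod_pos) (auto intro: prime_gt_0_nat)

lemma dvd_n: "p \<in> P \<Longrightarrow> p dvd n"
  unfolding n_eq using dvd_prodI[OF fin, of p "\<lambda>x. x"] by simp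

lemma odd_P: "p \<in> P \<Longrightarrow> odd p"
  using prime_odd_nat[of p] primes[of p] ge13[of p] by simp

lemma odd_n: "odd n"
  unfolding n_eq using odd_P fin by (subst even_prod_iff) auto

lemma Psi_one: "p \<in> P \<Longrightarrow> \<Psi> p 1 = 1"
proof -
  assume p: "p \<in> P"
  have "\<Psi> p 1 * \<Psi> p 1 = \<Psi> p 1" using Psi_mult[OF p, of 1 1] by simp
  moreover have "\<Psi> p 1 \<noteq> 0" using Psi_0[OF p] primes[OF p] by (simp add: prime_nat_iff)
  ultimately show ?thesis by simp
qed

lemma coprime_iff: "coprime a (4 * n) \<longleftrightarrow> odd a \<and> (\<forall>p\<in>P. \<not> p dvd a)"
proof -
  have "coprime a n \<longleftrightarrow> (\<forall>p\<in>P. \<not> p dvd a)"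
  proof
    assume a: "coprime a n"
    show "\<forall>p\<in>P. \<not> p dvd a"
      using a dvd_n primes by (metis coprime_common_divisor not_prime_unit)
  next
    assume "\<forall>p\<in>P. \<not> p dvd a"
    hence "\<forall>p\<in>P. coprime a p" using primes by (metis coprime_commute prime_imp_coprime)
    thus "coprime a n" unfolding n_eq by (intro prod_coprime_right) auto
  qed
  thus ?thesis by (simp add: coprime_4_iff_odd)
qed

lemma cong_n_iff: "[a = b] (mod n) \<longleftrightarrow> (\<forall>p\<in>P. [a = b] (mod p))"
proof
  assume "[a = b] (mod n)"
  thus "\<forall>p\<in>P. [a = b] (mod p)" using dvd_n cong_dvd_modulus_nat by blast
next
  assume "\<forall>p\<in>P. [a = b] (mod p)"
  thus "[a = b] (mod n)" unfolding n_eq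
    using coprime_cong_prod_nat[of P "\<lambda>p. p" a b] primes primes_coprime by blast
qed

text \<open>Such a u acts as a primitive root at p and trivially at 4 and at the other primes, so
  evaluating \<open>X j\<close> at it isolates the exponent at p.\<close>

lemma crt:
  assumes p: "p \<in> P"
  shows "\<exists>u. [u = g p] (mod p) \<and> [u = 1] (mod 4 * \<Prod>(P - {p}))"
proof -
  have "coprime p (\<Prod>(P - {p}))"
    using primes_coprime[OF primes[OF p] primes] by (intro prod_coprime_right) force
  moreover have "coprime p 4" using odd_P[OF p] by (simp add: coprime_4_iff_odd)
  ultimately have "coprime p (4 * \<Prod>(P - {p}))" by simp
  thus ?thesis by (rule binary_chinese_remainder_nat)
qed

lemma X_at_generator:
  assumes p: "p \<in> P" and u: "[u = g p] (mod p)" "[u = 1] (mod 4 * \<Prod>(P - {p}))"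
  shows "X j u = \<Psi> p (g p) ^ j p"
proof -
  have "[u = 1] (mod 4)" using u(2) cong_dvd_modulus_nat by (metis dvd_triv_left)
  hence "chi4 u = 1" using chi4_cong[of u 1] by (simp add: chi4_def)
  moreover have "\<Psi> r u ^ j r = 1" if "r \<in> P - {p}" for r
  proof -
    have "r dvd \<Prod>(P - {p})" using dvd_prodI[of "P - {p}" r "\<lambda>x. x"] that fin by simp
    hence "[u = 1] (mod r)" using u(2) cong_dvd_modulus_nat by (metis dvd_mult)
    thus ?thesis using that Psi_cong[of r u 1] Psi_one by simp
  qed
  hence "(\<Prod>r\<in>P - {p}. \<Psi> r u ^ j r) = 1" by (intro prod.neutral) auto
  moreover have "\<Psi> p u = \<Psi> p (g p)" using Psi_cong p u by blast
  ultimately show ?thesis using fin p by (simp add: X_def prod.remove)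
qed

lemma J_pos: "j \<in> PiE P J \<Longrightarrow> p \<in> P \<Longrightarrow> 0 < j p \<and> j p < p - 1"
  by (force simp: PiE_iff J_def split: if_splits)

lemma character_X:
  assumes j: "j \<in> PiE P J"
  shows "dirichlet_character (4 * n) (X j)"
proof
  show "4 * n > 0" using n_pos by simp
  show "X j (a * b) = X j a * X j b" for a b
    by (simp add: X_def chi4_mult Psi_mult power_mult_distrib prod.distrib mult_ac cong: prod.cong)
  show "X j (a + 4 * n) = X j a" for a
  proof -
    have "chi4 (a + 4 * n) = chi4 a" by (rule chi4_cong) (simp add: unique_euclidean_semiring_class.cong_def)
    moreover have "\<Psi> p (a + 4 * n) = \<Psi> p a" if p: "p \<in> P" for p
    proof (rule Psi_cong[OF p])
      have "[4 * n = 0] (mod p)" using dvd_n[OF p] by (simp add: cong_0_iff)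
      thus "[a + 4 * n = a] (mod p)" using cong_add[of a a p "4 * n" 0] by simp
    qed
    ultimately show ?thesis by (simp add: X_def cong: prod.cong)
  qed
  show "X j a = 0 \<longleftrightarrow> \<not> coprime a (4 * n)" for a
    unfolding coprime_iff X_def using fin J_pos[OF j] by (auto simp: chi4_def Psi_0 power_0_left)
qed

text \<open>The residue 1 + 2n is trivial modulo n but, n being odd, nontrivial modulo 4, so only
  the factor \<open>chi4\<close> sees it.\<close>

lemma X_half: "X j (1 + 2 * n) = - 1"
proof -
  have "(1 + 2 * n) mod 4 = 3" using odd_n by presburger
  hence "chi4 (1 + 2 * n) = - 1" by (simp add: chi4_def)
  moreover have "\<Psi> p (1 + 2 * n) = 1" if p: "p \<in> P" for p
  proof -
    have "[2 * n = 0] (mod p)" using dvd_n[OF p] by (simp add: cong_0_iff)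
    hence "[1 + 2 * n = 1] (mod p)" using cong_add[of 1 1 p "2 * n" 0] by simp
    thus ?thesis using Psi_cong[OF p] Psi_one[OF p] by metis
  qed
  ultimately show ?thesis by (simp add: X_def)
qed

text \<open>At the lifted generator of q, a square equal to 1 would force the exponent (q - 1) / 2,
  the one removed from \<open>J q\<close>.\<close>

lemma X_nonreal:
  assumes j: "j \<in> PiE P J"
  shows "\<exists>u. coprime u (4 * n) \<and> X j u ^ 2 \<noteq> 1"
proof -
  interpret dirichlet_character "4 * n" "X j" by (rule character_X[OF j])
  obtain u where u: "[u = g q] (mod q)" "[u = 1] (mod 4 * \<Prod>(P - {q}))" using crt[OF q(1)] by blast
  have Xu: "X j u = \<Psi> q (g q) ^ j q" by (rule X_at_generator[OF q(1) u])
  hence "X j u \<noteq> 0" using Psi_0[OF q(1)] g[OF q(1)] by simp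
  moreover have "X j u ^ 2 \<noteq> 1"
  proof
    assume "X j u ^ 2 = 1"
    hence "(q - 1) dvd j q * 2" using Psi_g[OF q(1), of "j q * 2"] by (simp add: Xu power_mult)
    then obtain m where m: "j q * 2 = (q - 1) * m" by (auto elim: dvdE)
    have jq: "0 < j q" "j q < q - 1" "j q \<noteq> (q - 1) div 2"
      using J_pos[OF j q(1)] j q(1) by (auto simp: PiE_iff J_def)
    have "m \<noteq> 0" using m jq by (metis mult_is_0 not_gr_zero zero_neq_numeral)
    moreover have "m < 2"
    proof (rule ccontr)
      assume "\<not> m < 2"
      hence "(q - 1) * 2 \<le> (q - 1) * m" by (intro mult_left_mono) auto
      thus False using jq(2) unfolding m[symmetric] by linarith
    qed
    ultimately have "m = 1" by simp
    thus False using m jq by simp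
  qed
  ultimately show ?thesis using eq_0_iff by blast
qed

text \<open>Multiplication by 1 + 2n fixes an even k, and multiplication by the lifted generator at
  p fixes a multiple of p. The characters are nontrivial on both units, on the latter because the
  exponent lies strictly between 0 and p - 1.\<close>

lemma primitive_X:
  assumes j: "j \<in> PiE P J"
  shows "primitive_character (4 * n) (X j)"
proof -
  interpret dirichlet_character "4 * n" "X j" by (rule character_X[OF j])
  show ?thesis
  proof
    show "4 * n > 1" using n_pos by simp
    fix k assume "\<not> coprime k (4 * n)"
    then consider "even k" | p where "p \<in> P" "p dvd k" using coprime_iff by blast
    thus "\<exists>u. coprime u (4 * n) \<and> [u * k = k] (mod 4 * n) \<and> X j u \<noteq> 1"
    proof cases
      case 1
      have "[(1 + 2 * n) * k = k] (mod 4 * n)"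
      proof -
        obtain m where "k = 2 * m" using 1 by (rule evenE)
        hence "(1 + 2 * n) * k = k + m * (4 * n)" by (simp add: algebra_simps)
        thus ?thesis by (simp only: unique_euclidean_semiring_class.cong_def mod_mult_self1)
      qed
      moreover have "coprime (1 + 2 * n) (4 * n)" using X_half eq_0_iff[of "1 + 2 * n"] by force
      ultimately show ?thesis using X_half by (intro exI[of _ "1 + 2 * n"]) simp
    next
      case 2
      obtain u where u: "[u = g p] (mod p)" "[u = 1] (mod 4 * \<Prod>(P - {p}))" using crt[OF 2(1)] by blast
      have Xu: "X j u = \<Psi> p (g p) ^ j p" by (rule X_at_generator[OF 2(1) u])
      hence "X j u \<noteq> 0" using Psi_0[OF 2(1)] g[OF 2(1)] by simp
      moreover have "X j u \<noteq> 1"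
        unfolding Xu Psi_g[OF 2(1)] using J_pos[OF j 2(1)] by (auto dest: dvd_imp_le)
      moreover have "[u * k = k] (mod 4 * n)"
      proof -
        obtain m where m: "k = p * m" using 2 by blast
        have "[p * u = p * 1] (mod p * (4 * \<Prod>(P - {p})))"
          using u(2) cong_cmult_leftI by blast
        also have "p * (4 * \<Prod>(P - {p})) = 4 * n" unfolding n_eq using fin 2 by (simp add: prod.remove)
        finally have "[p * u * m = p * 1 * m] (mod 4 * n)" by (rule cong_scalar_right)
        thus ?thesis by (simp add: m mult_ac)
      qed
      ultimately show ?thesis using eq_0_iff by blast
    qed
  qed
qed

end

section \<open>Averaging over the family\<close>

context character_family
begin

definition S :: "nat \<Rightarrow> nat \<Rightarrow> complex" where "S p a = (\<Sum>k\<in>J p. \<Psi> p a ^ k)"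

definition W :: "nat \<Rightarrow> complex" where "W a = (\<Prod>p\<in>P. S p a)"

definition w :: real where "w = (\<Prod>p\<in>P. real (card (J p)))"

lemma finite_J: "finite (J p)"
  by (simp add: J_def)

lemma sum_X: "(\<Sum>j\<in>PiE P J. X j a) = chi4 a * W a"
  unfolding X_def W_def S_def sum_distrib_left[symmetric]
  by (subst prod_sum_PiE) (simp_all add: fin finite_J)

lemma card_J: "p \<in> P \<Longrightarrow> card (J p) = (if p = q then q - 3 else p - 2)"
proof -
  assume p: "p \<in> P"
  have "(q - 1) div 2 \<in> {1..<q - 1}" using q(2) by auto
  thus ?thesis by (auto simp: J_def)
qed

lemma card_J_ge: "p \<in> P \<Longrightarrow> card (J p) \<ge> 11"
  using ge13[of p] q(2) by (auto simp: card_J)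

lemma w_pos: "w > 0"
  unfolding w_def using card_J_ge by (intro prod_pos) fastforce

lemma S_eq: "p \<in> P \<Longrightarrow> [a = 1] (mod p) \<Longrightarrow> S p a = of_nat (card (J p))"
  using Psi_cong[of p a 1] Psi_one[of p] by (simp add: S_def)

text \<open>The geometric sum over all exponents from 0 to p - 2 vanishes, so the nonzero ones
  contribute -1; at q the removed power adds one more term of modulus 1. The ratio is thus 1 out of
  at least 11, or 2 out of at least 14.\<close>

lemma S_small:
  assumes p: "p \<in> P" "\<not> p dvd a" "\<not> [a = 1] (mod p)"
  shows "7 * norm (S p a) \<le> card (J p)"
proof -
  have z1: "\<Psi> p a \<noteq> 1" using Psi_1 p by blast
  have "norm (\<Psi> p a) = 1 \<or> p - 1 = 0" using Psi_order[OF p(1,2)] by (rule power_eq_1_iff)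
  hence nz: "norm (\<Psi> p a) = 1" using ge13[OF p(1)] by simp
  have "{..<p - 1} = insert 0 {1..<p - 1}" using ge13[OF p(1)] by auto
  hence "(\<Sum>k<p - 1. \<Psi> p a ^ k) = 1 + (\<Sum>k\<in>{1..<p - 1}. \<Psi> p a ^ k)" by simp
  moreover have "(\<Sum>k<p - 1. \<Psi> p a ^ k) = 0"
    using z1 Psi_order[OF p(1,2)] by (simp add: geometric_sum)
  ultimately have full: "(\<Sum>k\<in>{1..<p - 1}. \<Psi> p a ^ k) = - 1" by (simp add: eq_neg_iff_add_eq_0 add.commute)
  show ?thesis
  proof (cases "p = q")
    case True
    have "(q - 1) div 2 \<in> {1..<q - 1}" using q(2) by auto
    hence "S p a = - 1 - \<Psi> p a ^ ((q - 1) div 2)"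
      using full True by (simp add: S_def J_def sum_diff1)
    hence "norm (S p a) \<le> norm (- 1 :: complex) + norm (\<Psi> p a ^ ((q - 1) div 2))"
      using norm_triangle_ineq4 by metis
    hence "norm (S p a) \<le> 2" by (simp add: norm_power nz)
    thus ?thesis using q(2) True by (simp add: card_J[OF q(1)] of_nat_diff)
  next
    case False
    hence "S p a = - 1" using full by (simp add: S_def J_def)
    thus ?thesis using False ge13[OF p(1)] by (simp add: card_J[OF p(1)] of_nat_diff)
  qed
qed

lemma S_le:
  assumes p: "p \<in> P" "\<not> p dvd a"
  shows "norm (S p a) \<le> card (J p)"
proof (cases "[a = 1] (mod p)")
  case True
  thus ?thesis using S_eq p by simp
next
  case False
  from S_small[OF p False] show ?thesis using norm_ge_zero[of "S p a"] by linarith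
qed

lemma W_eq: "[a = 1] (mod n) \<Longrightarrow> W a = of_real w"
  using S_eq by (simp add: W_def w_def cong_n_iff)

text \<open>The average factors over the primes, so each prime at which a is not 1 saves its own
  factor 7. One prime is used for general a, two at a = -1.\<close>

lemma W_small:
  assumes A: "A \<subseteq> P" and a: "coprime a (4 * n)" "\<And>p. p \<in> A \<Longrightarrow> \<not> [a = 1] (mod p)"
  shows "7 ^ card A * norm (W a) \<le> w"
proof -
  have finA: "finite A" using A fin finite_subset by blast
  have "7 ^ card A * norm (W a) = (\<Prod>p\<in>A. 7 * norm (S p a)) * (\<Prod>p\<in>P - A. norm (S p a))"
    unfolding W_def prod.subset_diff[OF A fin]
    by (simp add: prod.distrib norm_mult prod_norm mult_ac)
  also have "\<dots> \<le> (\<Prod>p\<in>A. real (card (J p))) * (\<Prod>p\<in>P - A. real (card (J p)))"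
    using a(2) A a(1)[unfolded coprime_iff]
    by (intro mult_mono prod_mono conjI S_small S_le prod_nonneg mult_nonneg_nonneg) auto
  also have "\<dots> = w" unfolding w_def prod.subset_diff[OF A fin] by (simp add: mult.commute)
  finally show ?thesis .
qed

lemma W_small1:
  assumes "coprime a (4 * n)" "\<not> [a = 1] (mod n)"
  shows "norm (W a) \<le> w / 7"
proof -
  obtain p where "p \<in> P" "\<not> [a = 1] (mod p)" using assms cong_n_iff by blast
  thus ?thesis using W_small[of "{p}" a] assms by simp
qed

section \<open>Symmetrization under a -> -a\<close>

definition M :: nat where "M = 4 * n - 1"

text \<open>\<open>C\<close> is twice the sum over the even characters of the family, since \<open>M\<close> represents \<open>-1\<close>.\<close>

definition C :: "nat \<Rightarrow> complex" where "C a = chi4 a * W a + chi4 (M * a) * W (M * a)"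

lemma C_eq: "C a = (\<Sum>j\<in>PiE P J. X j a + X j (M * a))"
  by (simp add: C_def sum_X sum.distrib)

lemma M_cong: "d dvd 4 * n \<Longrightarrow> [M + 1 = 0] (mod d)" "[M * M = 1] (mod 4 * n)"
proof -
  show 1: "[M + 1 = 0] (mod d)" if "d dvd 4 * n" for d
    using that n_pos by (simp add: M_def cong_0_iff)
  have "[M * (M + 1) + 1 = M * 0 + 1] (mod 4 * n)"
    by (intro cong_add cong_mult 1) auto
  moreover have "M * (M + 1) + 1 = M * M + (M + 1)" by simp
  ultimately have "[M * M + (M + 1) = 1] (mod 4 * n)" by (simp only: mult_0_right add_0)
  moreover have "[M * M + (M + 1) = M * M + 0] (mod 4 * n)" by (intro cong_add 1) auto
  hence "[M * M + (M + 1) = M * M] (mod 4 * n)" by (simp only: add_0_right)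
  ultimately show "[M * M = 1] (mod 4 * n)" by (meson cong_sym cong_trans)
qed

lemma coprime_M: "coprime M (4 * n)"
  unfolding M_def by (rule coprime_diff_one_left_nat) (use n_pos in simp)

lemma M_not_1:
  assumes p: "p \<in> P" and a: "[a = 1] (mod p)"
  shows "\<not> [M * a = 1] (mod p)"
proof
  assume "[M * a = 1] (mod p)"
  hence 2: "[M * a + a = 1 + 1] (mod p)" using a by (intro cong_add)
  have "[(M + 1) * a = 0 * a] (mod p)"
    by (intro cong_scalar_right M_cong) (use dvd_n[OF p] in auto)
  hence "[M * a + a = 0] (mod p)" by (simp only: distrib_right mult_1 mult_0)
  hence "[1 + 1 = 0] (mod p)" by (rule cong_trans[OF cong_sym[OF 2]])
  hence "p dvd 2" by (simp add: cong_0_iff numeral_2_eq_2)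
  thus False using ge13[OF p] by (auto dest: dvd_imp_le)
qed

lemma norm_chi4: "norm (chi4 a) \<le> 1"
  by (simp add: chi4_def)

text \<open>The residue -1 differs from 1 at every prime, so two distinct primes bound the second
  term of \<open>C 1\<close> by w / 49.\<close>

lemma C_1: "Re (C 1) \<ge> 48 / 49 * w"
proof -
  obtain r where r: "r \<in> P" "r \<noteq> q" using other q(1) by blast
  have "\<not> [M = 1] (mod p)" if "p \<in> P" for p using M_not_1[OF that, of 1] by simp
  hence "7 ^ card {q, r} * norm (W M) \<le> w"
    using r q(1) coprime_M by (intro W_small) auto
  moreover have "card {q, r} = 2" using r by simp
  ultimately have "49 * norm (W M) \<le> w" by simp
  moreover have "norm (chi4 M * W M) \<le> norm (W M)"
    using norm_chi4 by (simp add: norm_mult mult_left_le_one_le)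
  ultimately have "Re (chi4 M * W M) \<ge> - (w / 49)"
    using abs_Re_le_cmod[of "chi4 M * W M"] by linarith
  moreover have "C 1 = of_real w + chi4 M * W M" using W_eq[of 1] by (simp add: C_def chi4_def)
  ultimately show ?thesis by simp
qed

lemma C_eq_C_1:
  assumes "[a = 1] (mod 4 * n) \<or> [a = M] (mod 4 * n)"
  shows "C a = C 1"
  unfolding C_eq
proof (rule sum.cong[OF refl])
  fix j assume "j \<in> PiE P J"
  then interpret dirichlet_character "4 * n" "X j" by (rule character_X)
  from assms show "X j a + X j (M * a) = X j 1 + X j (M * 1)"
  proof
    assume "[a = 1] (mod 4 * n)"
    from cong_modulus[OF this] show ?thesis by (simp add: mult)
  next
    assume "[a = M] (mod 4 * n)"
    moreover have "X j M * X j M = 1" using cong_modulus[OF M_cong(2)] by (simp add: mult)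
    ultimately show ?thesis using cong_modulus[of a M] by (simp add: mult)
  qed
qed

lemma chi4_W_antipodal:
  assumes a: "coprime a (4 * n)" "[a = 1] (mod n)" "\<not> [a = 1] (mod 4 * n)"
  shows "chi4 a * W a = - of_real w"
proof -
  have "coprime (4 :: nat) n" using odd_n coprime_4_iff_odd by (simp add: coprime_commute)
  hence "\<not> [a = 1] (mod 4)" using a(2,3) coprime_cong_mult_nat by blast
  hence "a mod 4 \<noteq> 1" by (simp add: unique_euclidean_semiring_class.cong_def)
  moreover have "odd a" using a(1) coprime_iff by blast
  ultimately have "chi4 a = - 1" by (simp add: chi4_def)
  thus ?thesis using W_eq[OF a(2)] by simp
qed

text \<open>If a = 1 modulo n, then \<open>W a\<close> is as large as possible, but a differs from 1
  modulo 4 and \<open>chi4\<close> makes the term negative. This is why the real part is bounded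
  from above rather than the modulus.\<close>

lemma chi4_W_le:
  assumes a: "coprime a (4 * n)" "\<not> [a = 1] (mod 4 * n)"
  shows "Re (chi4 a * W a) \<le> w / 7"
proof (cases "[a = 1] (mod n)")
  case True
  from chi4_W_antipodal[OF a(1) True a(2)] show ?thesis using w_pos by simp
next
  case False
  have "Re (chi4 a * W a) \<le> norm (chi4 a * W a)" by (rule complex_Re_le_cmod)
  also have "\<dots> \<le> norm (W a)" using norm_chi4 by (simp add: norm_mult mult_left_le_one_le)
  also have "\<dots> \<le> w / 7" by (rule W_small1[OF a(1) False])
  finally show ?thesis .
qed

lemma C_small:
  assumes a: "coprime a (4 * n)" "\<not> [a = 1] (mod 4 * n)" "\<not> [a = M] (mod 4 * n)"
  shows "Re (C a) \<le> 2 / 7 * w"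
proof -
  have "\<not> [M * a = 1] (mod 4 * n)"
  proof
    assume "[M * a = 1] (mod 4 * n)"
    hence "[M * (M * a) = M * 1] (mod 4 * n)" by (rule cong_scalar_left)
    moreover have "[M * M * a = 1 * a] (mod 4 * n)" by (rule cong_scalar_right[OF M_cong(2)])
    ultimately have "[a = M] (mod 4 * n)"
      unfolding mult.assoc mult_1 mult_1_right by (meson cong_sym cong_trans)
    thus False using a by simp
  qed
  moreover have "coprime (M * a) (4 * n)" using coprime_M a(1) by simp
  ultimately have "Re (chi4 (M * a) * W (M * a)) \<le> w / 7" by (intro chi4_W_le)
  thus ?thesis using chi4_W_le[OF a(1,2)] by (simp add: C_def)
qed

text \<open>Adding the value at -a multiplies each character by 1 + \<open>X j M\<close>, which
  kills the odd ones; the relation is therefore asked only of even characters. The factor b serves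
  to normalize a_0 to 1.\<close>

lemma relation_C:
  assumes rel: "\<And>j. j \<in> PiE P J \<Longrightarrow> X j M = 1 \<Longrightarrow> (\<Sum>i\<in>I. c i * X j (a i)) = 0"
  shows "(\<Sum>i\<in>I. c i * C (a i * b)) = 0"
proof -
  have "(\<Sum>i\<in>I. c i * C (a i * b)) = (\<Sum>j\<in>PiE P J. \<Sum>i\<in>I. c i * (X j (a i * b) + X j (M * (a i * b))))"
    unfolding C_eq sum_distrib_left by (rule sum.swap)
  also have "\<dots> = 0"
  proof (rule sum.neutral, rule ballI)
    fix j assume j: "j \<in> PiE P J"
    then interpret dirichlet_character "4 * n" "X j" by (rule character_X)
    have "X j M * X j M = 1" using cong_modulus[OF M_cong(2)] by (simp add: mult)
    hence "X j M = 1 \<or> X j M = - 1" by (simp add: square_eq_1_iff)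
    hence M: "X j M = 1 \<or> 1 + X j M = 0" by auto
    have "(\<Sum>i\<in>I. c i * (X j (a i * b) + X j (M * (a i * b)))) = (\<Sum>i\<in>I. (1 + X j M) * X j b * (c i * X j (a i)))"
      by (rule sum.cong) (simp_all add: mult algebra_simps)
    also have "\<dots> = (1 + X j M) * X j b * (\<Sum>i\<in>I. c i * X j (a i))" by (simp add: sum_distrib_left)
    also have "\<dots> = 0" using M rel[OF j] by auto
    finally show "(\<Sum>i\<in>I. c i * (X j (a i * b) + X j (M * (a i * b)))) = 0" .
  qed
  finally show ?thesis .
qed

text \<open>For odd b the two powers of z in \<open>h\<close> are negatives of each other, so h b =
  ln |tan (pi b / 4n)|. The range 0 < a i < 2n ensures that a i can be congruent to a i0 or its
  negative modulo 4n only by being equal to it, so large values of \<open>C\<close> detect exactly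
  the equal indices.\<close>

theorem two_equal:
  fixes a :: "nat \<Rightarrow> nat" and I :: "nat set"
  defines "z \<equiv> cis (2 * pi / real (4 * n))"
  defines "h \<equiv> (\<lambda>b. ln (norm (1 - z ^ b)) - ln (norm (1 - z ^ ((1 + 2 * n) * b))))"
  assumes cop: "\<And>i. i \<in> insert i0 I \<Longrightarrow> coprime (a i) (4 * n)"
    and bounds: "\<And>i. i \<in> insert i0 I \<Longrightarrow> 0 < a i \<and> a i < 2 * n"
    and I: "finite I" "i0 \<notin> I" "card I = 4"
    and rel: "\<And>b. coprime b (4 * n) \<Longrightarrow> 2 * h (a i0 * b) = (\<Sum>i\<in>I. h (a i * b))"
  shows "card {i \<in> I. a i = a i0} \<ge> 2"
proof (rule ccontr)
  assume "\<not> card {i \<in> I. a i = a i0} \<ge> 2"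
  hence card: "card {i \<in> I. a i = a i0} \<le> 1" by simp
  define c :: "nat \<Rightarrow> real" where "c = (\<lambda>i. if i = i0 then 2 else - 1)"
  have c: "(\<Sum>i\<in>insert i0 I. of_real (c i) * f i) = 2 * f i0 - (\<Sum>i\<in>I. f i)" for f :: "nat \<Rightarrow> 'x :: real_div_algebra"
  proof -
    have "(\<Sum>i\<in>I. of_real (c i) * f i) = (\<Sum>i\<in>I. - f i)"
      using I(2) by (intro sum.cong) (auto simp: c_def)
    thus ?thesis using I by (simp add: c_def sum_negf)
  qed
  have X: "(\<Sum>i\<in>insert i0 I. of_real (c i) * X j (a i)) = 0" if j: "j \<in> PiE P J" and M: "X j M = 1" for j
  proof -
    interpret primitive_character "4 * n" "X j" by (rule primitive_X[OF j])
    have z: "\<zeta> = z" by (simp add: \<zeta>_def z_def)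
    show ?thesis
    proof (rule translate_relation[where h = h])
      show "h (k mod (4 * n)) = h k" for k
      proof -
        have "z ^ ((1 + 2 * n) * (k mod (4 * n))) = z ^ ((1 + 2 * n) * k)"
          unfolding z[symmetric] zeta_eq_iff unique_euclidean_semiring_class.cong_def
          by (rule mod_mult_right_eq)
        thus ?thesis using zeta_mod[of k] by (simp add: h_def z)
      qed
      show "(\<Sum>b<4 * n. X j b * of_real (h b)) \<noteq> 0"
        using sum_ln_difference_nonzero[OF _ X_nonreal[OF j] X_half] M
        unfolding h_def z M_def by simp
      show "(\<Sum>i\<in>insert i0 I. c i * h (a i * b)) = 0" if "coprime b (4 * n)" for b
        using c[of "\<lambda>i. h (a i * b)"] rel[OF that] by simp
    qed (use I cop in auto)
  qed
  \<comment> \<open>Multiplying by the inverse b of a i0 moves the term of i0 to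
    \<open>C 1\<close>.\<close>
  obtain b where b: "[a i0 * b = 1] (mod 4 * n)"
    using cong_solve_coprime_nat[OF cop[of i0]] by auto
  have copb: "coprime b (4 * n)"
    using cong_imp_coprime[OF cong_sym[OF b]] by simp
  have "(\<Sum>i\<in>insert i0 I. of_real (c i) * C (a i * b)) = 0" by (rule relation_C) (rule X)
  hence "2 * C (a i0 * b) = (\<Sum>i\<in>I. C (a i * b))" unfolding c by simp
  moreover have "C (a i0 * b) = C 1" using b C_eq_C_1 by blast
  ultimately have "Re (2 * C 1) = Re (\<Sum>i\<in>I. C (a i * b))" by simp
  hence "2 * Re (C 1) = (\<Sum>i\<in>I. Re (C (a i * b)))" by simp
  also have "\<dots> \<le> (\<Sum>i\<in>I. 2 / 7 * w + (if a i = a i0 then Re (C 1) - 2 / 7 * w else 0))"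
  proof (rule sum_mono)
    fix i assume i: "i \<in> I"
    show "Re (C (a i * b)) \<le> 2 / 7 * w + (if a i = a i0 then Re (C 1) - 2 / 7 * w else 0)"
    proof (cases "a i = a i0")
      case True
      thus ?thesis using b C_eq_C_1[of "a i * b"] by simp
    next
      case False
      have undo: "[a i = y * a i0] (mod 4 * n)" if "[a i * b = y] (mod 4 * n)" for y
      proof -
        have "[a i * b * a i0 = y * a i0] (mod 4 * n)" using that by (rule cong_scalar_right)
        moreover have "[a i * (a i0 * b) = a i * 1] (mod 4 * n)" using b by (rule cong_scalar_left)
        moreover have "a i * b * a i0 = a i * (a i0 * b)" by simp
        ultimately show ?thesis by (metis cong_sym cong_trans mult_1_right)
      qed
      have "\<not> [a i * b = 1] (mod 4 * n)"
      proof
        assume "[a i * b = 1] (mod 4 * n)"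
        from undo[OF this] have "[a i = a i0] (mod 4 * n)" by simp
        thus False using False bounds[of i] bounds[of i0] i
          by (simp add: unique_euclidean_semiring_class.cong_def)
      qed
      moreover have "\<not> [a i * b = M] (mod 4 * n)"
      proof
        assume "[a i * b = M] (mod 4 * n)"
        from cong_add[OF undo[OF this] cong_refl[of "a i0"]]
        have "[a i + a i0 = (M + 1) * a i0] (mod 4 * n)" by (simp add: algebra_simps)
        moreover have "[(M + 1) * a i0 = 0 * a i0] (mod 4 * n)" by (intro cong_scalar_right M_cong) simp
        ultimately have "[a i + a i0 = 0 * a i0] (mod 4 * n)" by (rule cong_trans)
        hence "4 * n dvd a i + a i0" by (simp add: cong_0_iff)
        thus False using bounds[of i] bounds[of i0] i by (auto dest!: dvd_imp_le)
      qed
      moreover have "coprime (a i * b) (4 * n)" using cop[of i] i copb by simp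
      ultimately show ?thesis using C_small False by simp
    qed
  qed
  also have "\<dots> = 8 / 7 * w + card {i \<in> I. a i = a i0} * (Re (C 1) - 2 / 7 * w)"
    using I by (simp add: sum.distrib sum.If_cases Int_def)
  also have "\<dots> \<le> 8 / 7 * w + 1 * (Re (C 1) - 2 / 7 * w)"
    using card C_1 w_pos by (intro add_left_mono mult_right_mono) auto
  finally show False using C_1 w_pos by simp
qed

end

section \<open>The tangent relation\<close>

lemma den_rat_pi:
  assumes "x \<in> rat_pi" "x > 0"
  obtains u where "u > 0" "den x > 0" "x = real u / real (den x) * pi" "coprime u (den x)"
proof -
  obtain q where q: "x = real_of_rat q * pi" using assms(1) unfolding rat_pi_def by blast
  have "(THE q. real_of_rat q = x / pi) = q" using q by (intro the_equality) auto
  hence den: "den x = nat (snd (quotient_of q))" by (simp add: den_def)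
  obtain c d where cd: "quotient_of q = (c, d)" by fastforce
  have d: "d > 0" using quotient_of_denom_pos[OF cd] .
  have "coprime c d" using quotient_of_coprime[OF cd] .
  have "q = of_int c / of_int d" using quotient_of_div[OF cd] .
  hence x: "x = of_int c / of_int d * pi" using q by (simp add: of_rat_divide)
  have "c > 0" using x assms(2) d by (simp add: zero_less_mult_iff zero_less_divide_iff)
  show thesis
  proof (rule that[of "nat c"])
    show "x = real (nat c) / real (den x) * pi" using x \<open>c > 0\<close> d den cd by simp
    have "coprime (int (nat c)) (int (nat d))" using \<open>coprime c d\<close> \<open>c > 0\<close> d by simp
    thus "coprime (nat c) (den x)" by (simp only: den cd snd_conv coprime_int_iff)
  qed (use \<open>c > 0\<close> d den cd in auto)
qed

text \<open>Euler's formula i tan x = (exp(2ix) - 1) / (exp(2ix) + 1) with the denominator cleared;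
  it makes the tangent relation polynomial in z.\<close>

lemma cis_minus_one_eq_tan:
  assumes "cos x \<noteq> 0"
  shows "cis (2 * x) - 1 = \<i> * of_real (tan x) * (cis (2 * x) + 1)"
proof -
  have "Re (cis (2 * x)) = 2 * cos x ^ 2 - 1" "Im (cis (2 * x)) = 2 * sin x * cos x"
    by (simp_all add: cos_double_cos sin_double)
  moreover have "tan x * cos x = sin x" using assms by (simp add: tan_def)
  hence "tan x * (2 * sin x * cos x) = 2 * sin x ^ 2" "tan x * (2 * cos x ^ 2) = 2 * sin x * cos x"
    by (simp_all add: power2_eq_square mult_ac)
  moreover have "sin x ^ 2 = 1 - cos x ^ 2" by (simp add: sin_squared_eq)
  ultimately show ?thesis by (simp add: complex_eq_iff)
qed

text \<open>Clearing denominators produces i^2 = -1 from the square and i^(card I) = 1 from the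
  product. The relation thus has integer coefficients, the former factor explaining the plus sign in
  \<open>p\<close>, and it survives conjugation. Moduli and logarithms then give the claim.\<close>

lemma log_relation:
  fixes n :: nat and a :: "nat \<Rightarrow> nat" and x :: "nat \<Rightarrow> real"
  defines "z \<equiv> cis (2 * pi / real (4 * n))"
  defines "h \<equiv> (\<lambda>b. ln (norm (1 - z ^ b)) - ln (norm (1 - z ^ ((1 + 2 * n) * b))))"
  assumes n: "n > 0" and I: "finite I" and card: "4 dvd card I"
    and tan: "tan (x 0) ^ 2 = (\<Prod>i\<in>I. tan (x i))"
    and x: "\<And>i. i \<in> insert 0 I \<Longrightarrow> x i = pi * real (a i) / real (4 * n) \<and> cos (x i) \<noteq> 0 \<and> coprime (a i) (4 * n)"
    and b: "coprime b (4 * n)"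
  shows "2 * h (a 0 * b) = (\<Sum>i\<in>I. h (a i * b))"
proof -
  have zN: "z ^ (4 * n) = 1" unfolding z_def using n cis_2pi_power_eq_iff[of "4 * n" "4 * n" 0]
    by (simp add: cong_0_iff)
  have ev: "z ^ a i - 1 = \<i> * of_real (tan (x i)) * (z ^ a i + 1)" if "i \<in> insert 0 I" for i
  proof -
    have zi: "z ^ a i = cis (2 * x i)" using x[OF that] by (simp add: z_def Complex.DeMoivre mult_ac)
    show ?thesis unfolding zi by (rule cis_minus_one_eq_tan) (use x[OF that] in blast)
  qed
  define p :: "int poly" where
    "p = (monom 1 (a 0) - 1) ^ 2 * (\<Prod>i\<in>I. monom 1 (a i) + 1) + (monom 1 (a 0) + 1) ^ 2 * (\<Prod>i\<in>I. monom 1 (a i) - 1)"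
  have hom: "ipoly_at (\<Prod>i\<in>I. f i) y = (\<Prod>i\<in>I. ipoly_at (f i) y)" for f :: "nat \<Rightarrow> int poly" and y
    by (simp add: of_int_poly_hom.hom_prod poly_prod)
  have hom1: "ipoly_at 1 y = 1" "ipoly_at (f - 1) y = ipoly_at f y - 1" for y and f :: "int poly"
    by (simp_all add: of_int_poly_hom.hom_minus)
  have p: "ipoly_at p y = (y ^ a 0 - 1) ^ 2 * (\<Prod>i\<in>I. y ^ a i + 1) + (y ^ a 0 + 1) ^ 2 * (\<Prod>i\<in>I. y ^ a i - 1)" for y
    unfolding p_def ipoly_at_hom hom hom1 ..
  have "(\<Prod>i\<in>I. z ^ a i - 1) = (\<Prod>i\<in>I. \<i> * of_real (tan (x i)) * (z ^ a i + 1))"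
    using ev by (intro prod.cong) auto
  also have "\<dots> = \<i> ^ card I * of_real (\<Prod>i\<in>I. tan (x i)) * (\<Prod>i\<in>I. z ^ a i + 1)"
    by (simp add: prod.distrib)
  also have "\<i> ^ card I = 1"
  proof -
    obtain m where m: "card I = 4 * m" using card by blast
    have "\<i> ^ 4 = (1 :: complex)" by (simp add: power4_eq_xxxx)
    thus ?thesis unfolding m power_mult by simp
  qed
  finally have "(\<Prod>i\<in>I. z ^ a i - 1) = of_real (tan (x 0)) ^ 2 * (\<Prod>i\<in>I. z ^ a i + 1)"
    using tan by (simp flip: of_real_power)
  moreover have "(z ^ a 0 - 1) ^ 2 = - (of_real (tan (x 0)) ^ 2) * (z ^ a 0 + 1) ^ 2"
    unfolding ev[OF insertI1] by (simp add: power_mult_distrib)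
  ultimately have "ipoly_at p z = 0" unfolding p by simp
  hence "ipoly_at p (z ^ b) = 0" using root_of_unity_conjugate[OF zN _ _ b] n by simp
  hence "((z ^ b) ^ a 0 - 1) ^ 2 * (\<Prod>i\<in>I. (z ^ b) ^ a i + 1) = - (((z ^ b) ^ a 0 + 1) ^ 2 * (\<Prod>i\<in>I. (z ^ b) ^ a i - 1))"
    unfolding p by (simp add: eq_neg_iff_add_eq_0)
  hence norms: "norm ((z ^ b) ^ a 0 - 1) ^ 2 * (\<Prod>i\<in>I. norm ((z ^ b) ^ a i + 1)) = norm ((z ^ b) ^ a 0 + 1) ^ 2 * (\<Prod>i\<in>I. norm ((z ^ b) ^ a i - 1))"
    by (metis (no_types, lifting) norm_minus_cancel norm_mult norm_power prod_norm prod.cong)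
  \<comment> \<open>Since z^(2n) = -1 and a i * b is odd, \<open>B i\<close> is the modulus of 1 +
    z^(a i * b), written in the form that occurs in \<open>h\<close>.\<close>
  define A B where "A = (\<lambda>i. norm (1 - z ^ (a i * b)))" and "B = (\<lambda>i. norm (1 - z ^ ((1 + 2 * n) * (a i * b))))"
  have AB: "norm ((z ^ b) ^ a i - 1) = A i" "norm ((z ^ b) ^ a i + 1) = B i" "A i > 0" "B i > 0"
    if i: "i \<in> insert 0 I" for i
  proof -
    have cop: "coprime (a i * b) (4 * n)" using x[OF i] b by simp
    hence odd: "odd (a i * b)" by (simp add: coprime_4_iff_odd)
    have e: "(z ^ b) ^ a i = z ^ (a i * b)" by (simp add: mult.commute flip: power_mult)
    have "z ^ (2 * n) = cis pi" using n by (simp add: z_def Complex.DeMoivre)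
    hence "z ^ (2 * n) = - 1" by simp
    moreover have "(1 + 2 * n) * (a i * b) = a i * b + 2 * n * (a i * b)" by (simp add: algebra_simps)
    ultimately have half: "z ^ ((1 + 2 * n) * (a i * b)) = - (z ^ (a i * b))"
      using odd by (simp only: power_add power_mult[of _ "2 * n"] minus_one_power_iff if_False) simp
    show "norm ((z ^ b) ^ a i - 1) = A i" by (simp add: A_def e norm_minus_commute)
    show "norm ((z ^ b) ^ a i + 1) = B i" unfolding B_def half by (simp add: e add.commute)
    have ne: "z ^ k \<noteq> 1" if "coprime k (4 * n)" for k
    proof
      assume "z ^ k = 1"
      hence "[k = 0] (mod 4 * n)" using cis_2pi_power_eq_iff[of "4 * n" k 0] n by (simp add: z_def)
      hence "4 * n dvd k" by (simp add: cong_0_iff)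
      hence "4 * n dvd 1" using that by (metis coprime_absorb_right)
      thus False by simp
    qed
    show "A i > 0" using ne[OF cop] by (simp add: A_def)
    have "z ^ (a i * b) \<noteq> - 1"
    proof
      assume "z ^ (a i * b) = - 1"
      hence "z ^ (2 * (a i * b)) = 1" by (simp add: mult.commute[of 2] power_mult)
      hence "[2 * (a i * b) = 0] (mod 4 * n)" using cis_2pi_power_eq_iff[of "4 * n" "2 * (a i * b)" 0] n by (simp add: z_def)
      hence "2 * (2 * n) dvd 2 * (a i * b)" by (simp add: cong_0_iff)
      hence "2 * n dvd a i * b" by (simp add: mult.commute)
      thus False using odd by (meson dvd_mult_left dvd_trans even_mult_iff)
    qed
    thus "B i > 0" unfolding B_def half by (simp add: add_eq_0_iff)
  qed
  have pos: "(\<Prod>i\<in>I. A i) > 0" "(\<Prod>i\<in>I. B i) > 0" "A 0 > 0" "B 0 > 0"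
    using AB by (auto intro!: prod_pos)
  have eq: "A 0 ^ 2 * (\<Prod>i\<in>I. B i) = B 0 ^ 2 * (\<Prod>i\<in>I. A i)"
    using norms AB by simp
  have "2 * ln (A 0) + ln (\<Prod>i\<in>I. B i) = ln (A 0 ^ 2 * (\<Prod>i\<in>I. B i))"
    using pos by (simp add: ln_mult ln_realpow)
  also have "\<dots> = 2 * ln (B 0) + ln (\<Prod>i\<in>I. A i)"
    unfolding eq using pos by (simp add: ln_mult ln_realpow)
  finally have "2 * ln (A 0) + ln (\<Prod>i\<in>I. B i) = 2 * ln (B 0) + ln (\<Prod>i\<in>I. A i)" .
  moreover have "A i \<noteq> 0" "B i \<noteq> 0" if "i \<in> I" for i
    using AB(3,4)[of i] that by auto
  hence "ln (\<Prod>i\<in>I. A i) = (\<Sum>i\<in>I. ln (A i))" "ln (\<Prod>i\<in>I. B i) = (\<Sum>i\<in>I. ln (B i))"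
    using I by (auto intro!: ln_prod)
  ultimately have "2 * (ln (A 0) - ln (B 0)) = (\<Sum>i\<in>I. ln (A i) - ln (B i))"
    by (simp add: sum_subtractf)
  thus ?thesis by (simp only: h_def A_def B_def)
qed

text \<open>Squarefreeness makes n the product of its prime factors. Non-primality rules out {13} as
  the set of these factors, so one of them exceeds 13 and is then at least 17.\<close>

lemma exists_character_family:
  assumes "n \<ge> 3" "squarefree n" "\<not> prime n" and large: "\<And>p. prime p \<Longrightarrow> p dvd n \<Longrightarrow> p > 11"
  shows "\<exists>P q \<Psi> g. character_family P q n \<Psi> g"
proof -
  define P where "P = prime_factors n"
  have n0: "n \<noteq> 0" using assms(1) by simp
  have P: "finite P" "\<And>p. p \<in> P \<Longrightarrow> prime p \<and> p dvd n" using n0 by (auto simp: P_def)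
  have "n = (\<Prod>p\<in>P. p ^ multiplicity p n)"
    using prod_prime_factors[OF n0] by (simp add: P_def)
  also have "\<dots> = \<Prod>P"
    using assms(2) squarefree_factorial_semiring'[OF n0] by (intro prod.cong) (auto simp: P_def)
  finally have n: "n = \<Prod>P" .
  have not_single: "P \<noteq> {p}" for p
    using n P(2)[of p] assms(3) by auto
  have nonempty: "P \<noteq> {}" using n assms(1) by auto
  have ge13: "p \<ge> 13" if "p \<in> P" for p
  proof -
    have "p > 11" using P(2)[OF that] large by blast
    moreover have "\<not> prime (12 :: nat)" by (simp add: prime_nat_numeral_eq)
    hence "p \<noteq> 12" using P(2)[OF that] by metis
    ultimately show ?thesis by simp
  qed
  obtain q where q: "q \<in> P" "q \<noteq> 13"
    using nonempty not_single[of 13] by blast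
  have "q \<ge> 17"
  proof (rule ccontr)
    assume "\<not> q \<ge> 17"
    hence "q = 14 \<or> q = 15 \<or> q = 16" using ge13[OF q(1)] q(2) by linarith
    moreover have "\<not> prime (14 :: nat)" "\<not> prime (15 :: nat)" "\<not> prime (16 :: nat)"
      by (simp_all add: prime_nat_numeral_eq)
    ultimately show False using P(2)[OF q(1)] by metis
  qed
  moreover have "\<forall>p. \<exists>\<psi> g. p \<in> P \<longrightarrow> generating_character p \<psi> g"
    using prime_generating_character P(2) by blast
  then obtain \<Psi> g where "\<And>p. p \<in> P \<Longrightarrow> generating_character p (\<Psi> p) (g p)" by metis
  ultimately have "character_family P q n \<Psi> g"
    using P ge13 q(1) n not_single by unfold_locales auto
  thus ?thesis by blast
qed

lemma tan_mult_eq_1_imp: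
  assumes "0 < x" "x < pi / 2" "0 < y" "y < pi / 2" "tan x * tan y = 1"
  shows "y = pi / 2 - x"
proof -
  have "tan x > 0" using assms by (intro tan_gt_zero) auto
  hence "tan y = inverse (tan x)" using assms(5) by (simp add: field_simps)
  also have "\<dots> = tan (pi / 2 - x)" by (simp add: tan_cot)
  finally show ?thesis using assms tan_monotone'[of y "pi / 2 - x"] tan_monotone'[of "pi / 2 - x" y]
    by (smt (verit))
qed

theorem theorem9p1:
  fixes n :: nat and x :: "nat \<Rightarrow> real"
  assumes "n \<ge> 3" and "odd n" and "squarefree n" and "\<not> prime n"
    and "\<And>p. prime p \<Longrightarrow> p dvd n \<Longrightarrow> p > 11"
    and "\<And>i. i \<le> 4 \<Longrightarrow> x i \<in> rat_pi"
    and "(tan (x 0))\<^sup>2 = tan (x 1) * tan (x 2) * tan (x 3) * tan (x 4)"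
    and "\<And>i. i \<le> 4 \<Longrightarrow> 0 < x i \<and> x i < pi / 2"
    and "\<And>i. i \<le> 4 \<Longrightarrow> den (x i) = 4 * n"
  shows "\<exists>\<sigma> (s::rat) (t::rat). \<sigma> permutes {1..4::nat} \<and>
           0 < s \<and> s < 1/2 \<and> 0 < t \<and> t \<le> 1/4 \<and>
           x 0 = real_of_rat s * pi \<and>
           x (\<sigma> 1) = real_of_rat s * pi \<and>
           x (\<sigma> 2) = real_of_rat s * pi \<and>
           x (\<sigma> 3) = real_of_rat t * pi \<and>
           x (\<sigma> 4) = (1/2 - real_of_rat t) * pi"
proof -
  define I where "I = {1..4::nat}"
  have ins: "i \<le> 4" if "i \<in> insert 0 I" for i using that by (auto simp: I_def)
  have prodI: "(\<Prod>i\<in>I. f i) = f 1 * f 2 * f 3 * f 4" for f :: "nat \<Rightarrow> real"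
    by (simp add: I_def numeral_eq_Suc prod.atLeast_Suc_atMost mult.assoc)
  have "\<exists>u. u > 0 \<and> x i = real u / real (4 * n) * pi \<and> coprime u (4 * n)" if "i \<le> 4" for i
    using den_rat_pi[of "x i"] assms(6,8,9)[OF that] by metis
  then obtain a where a: "\<And>i. i \<le> 4 \<Longrightarrow> a i > 0 \<and> x i = real (a i) / real (4 * n) * pi \<and> coprime (a i) (4 * n)"
    by metis
  have a2: "a i < 2 * n" if "i \<le> 4" for i
  proof -
    have "real (a i) / real (4 * n) * pi < 1 / 2 * pi" using a[OF that] assms(8)[OF that] by simp
    hence "real (a i) / real (4 * n) < 1 / 2" by (subst (asm) mult_less_cancel_right_pos) auto
    hence "real (a i) < real (2 * n)" using assms(1) by (simp add: field_simps)
    thus ?thesis by (simp only: of_nat_less_iff)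
  qed
  obtain P q \<Psi> g where "character_family P q n \<Psi> g"
    using exists_character_family[OF assms(1,3,4,5)] by blast
  then interpret character_family P q n \<Psi> g .
  have "card {i \<in> I. a i = a 0} \<ge> 2"
  proof (rule two_equal)
    fix b assume b: "coprime b (4 * n)"
    show "2 * (ln (norm (1 - cis (2 * pi / real (4 * n)) ^ (a 0 * b))) - ln (norm (1 - cis (2 * pi / real (4 * n)) ^ ((1 + 2 * n) * (a 0 * b)))))
      = (\<Sum>i\<in>I. ln (norm (1 - cis (2 * pi / real (4 * n)) ^ (a i * b))) - ln (norm (1 - cis (2 * pi / real (4 * n)) ^ ((1 + 2 * n) * (a i * b)))))"
    proof (rule log_relation[OF n_pos _ _ _ _ b])
      show "(tan (x 0))\<^sup>2 = (\<Prod>i\<in>I. tan (x i))" unfolding prodI by (rule assms(7))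
      show "x i = pi * real (a i) / real (4 * n) \<and> cos (x i) \<noteq> 0 \<and> coprime (a i) (4 * n)" if "i \<in> insert 0 I" for i
        using a[OF ins[OF that]] cos_gt_zero[of "x i"] assms(8)[OF ins[OF that]] by (simp add: mult.commute)
    qed (simp_all add: I_def)
  qed (use a a2 ins in \<open>auto simp: I_def\<close>)
  then obtain T where T: "T \<subseteq> {i \<in> I. a i = a 0}" "card T = 2"
    by (rule obtain_subset_with_card_n)
  from T(2) obtain i j where "T = {i, j}" "i \<noteq> j" unfolding card_2_iff by blast
  hence ij: "i \<noteq> j" "{i, j} \<subseteq> {i \<in> I. a i = a 0}" using T(1) by auto
  have "card (I - {i, j}) = 2" using ij by (simp add: card_Diff_subset I_def)
  then obtain k' l' where kl': "I - {i, j} = {k', l'}" "k' \<noteq> l'" by (auto simp: card_2_iff)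
  \<comment> \<open>The two remaining angles will add up to pi / 2; calling the smaller one
    \<open>x k\<close> is what yields t <= 1/4.\<close>
  define k l where "k = (if x k' \<le> x l' then k' else l')" and "l = (if x k' \<le> x l' then l' else k')"
  have kl: "I - {i, j} = {k, l}" "k \<noteq> l" "x k \<le> x l" using kl' by (auto simp: k_def l_def)
  have I: "I = {i, j, k, l}" and dist: "distinct [i, j, k, l]" using ij kl by auto
  have pos: "0 < x m" "x m < pi / 2" "tan (x m) > 0" if "m \<le> 4" for m
    using assms(8)[OF that] by (auto intro: tan_gt_zero)
  have le4: "i \<le> 4" "j \<le> 4" "k \<le> 4" "l \<le> 4" using I by (auto simp: I_def)
  have xij: "x i = x 0" "x j = x 0" using ij a[of 0] a[OF le4(1)] a[OF le4(2)] by auto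
  have "(tan (x 0))\<^sup>2 = (\<Prod>i\<in>I. tan (x i))" unfolding prodI by (rule assms(7))
  also have "\<dots> = tan (x i) * tan (x j) * tan (x k) * tan (x l)" unfolding I using dist by simp
  \<comment> \<open>The tangents at the two coinciding indices cancel against the square.\<close>
  finally have "(tan (x 0))\<^sup>2 * 1 = (tan (x 0))\<^sup>2 * (tan (x k) * tan (x l))"
    unfolding xij by (simp add: power2_eq_square)
  hence "tan (x k) * tan (x l) = 1" using pos(3)[of 0] by simp
  hence xl: "x l = pi / 2 - x k" using pos[OF le4(3)] pos[OF le4(4)] by (intro tan_mult_eq_1_imp)
  define s t :: rat where "s = of_nat (a 0) / of_nat (4 * n)" and "t = of_nat (a k) / of_nat (4 * n)"
  have s: "x 0 = real_of_rat s * pi" and t: "x k = real_of_rat t * pi"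
    using a[of 0] a[OF le4(3)] by (simp_all add: s_def t_def of_rat_divide of_rat_mult)
  have "0 < s" "0 < t" using a[of 0] a[OF le4(3)] n_pos by (simp_all add: s_def t_def)
  moreover have "s < 1 / 2"
  proof -
    have "real_of_rat s * pi < 1 / 2 * pi" using pos(2)[of 0] s by simp
    hence "real_of_rat s < real_of_rat (1 / 2)" by (subst (asm) mult_less_cancel_right_pos) (auto simp: of_rat_divide)
    thus ?thesis by (simp only: of_rat_less)
  qed
  moreover have "t \<le> 1 / 4"
  proof -
    have "real_of_rat t * pi \<le> 1 / 4 * pi" using kl(3) xl t by simp
    hence "real_of_rat t \<le> real_of_rat (1 / 4)" by (subst (asm) mult_le_cancel_right_pos) (auto simp: of_rat_divide)
    thus ?thesis by (simp only: of_rat_less_eq)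
  qed
  moreover have "(1/2 - real_of_rat t) * pi = x l" using xl t by (simp add: algebra_simps)
  moreover define \<sigma> where "\<sigma> = (\<lambda>m. if m = 1 then i else if m = 2 then j else if m = 3 then k else if m = 4 then l else m)"
  have \<sigma>: "\<sigma> 1 = i" "\<sigma> 2 = j" "\<sigma> 3 = k" "\<sigma> 4 = l" by (simp_all add: \<sigma>_def)
  have I1: "{1..4::nat} = {1, 2, 3, 4}" by auto
  have "\<sigma> permutes {1..4}"
  proof (rule bij_imp_permutes)
    have "\<sigma> ` {1..4} = {i, j, k, l}" unfolding I1 by (simp add: \<sigma>[unfolded One_nat_def])
    also have "\<dots> = {1..4}" using I by (simp add: I_def)
    finally have "\<sigma> ` {1..4} = {1..4}" .
    thus "bij_betw \<sigma> {1..4} {1..4}" by (simp add: bij_betw_def eq_card_imp_inj_on)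
  qed (auto simp: \<sigma>_def)
  ultimately show ?thesis using s t xij \<sigma> by metis
qed

end
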